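(* Let $r\ge 1$ be an integer, let $\gamma>0$ and $\alpha_1,\dots,\alpha_r>0$ be real numbers, and let $(\gamma_n)_{n\ge 0}$ be a sequence of positive real numbers such that for each $k\in\{1,\dots,r\}$ $$\lim_{n\to\infty,\ n\equiv k-1 \bmod r}\ \frac{\gamma_n}{n^\gamma}=\alpha_k .$$ Let $(P_n)_{n\ge0}$ be the monic polynomials defined by $P_n(z)=z^n$ for $0\le n\le r$ and $$P_{n+1}(z)=zP_n(z)-\gamma_{n-r}P_{n-r}(z),\qquad n\ge r,$$ and for positive integers $N$ put $Q_n(z,N)=N^{-\frac{n\gamma}{r+1}}P_n\big(N^{\frac{\gamma}{r+1}}z\big)$. Let $\Sigma=\bigcup_{k=0}^{r}\{x\,\omega_{r+1}^k: x\ge 0\}$ with $\omega_{r+1}=e^{2\pi i/(r+1)}$. Then for every $t>0$ $$\lim_{n\to\infty,\ n/N\to t}\frac{Q_n(z,N)}{Q_{n+r}(z,N)}=\Phi(z,t),$$ uniformly on compact subsets $K$ of $\mathbb{C}\setminus\Sigma$, where $\Phi$ is a solution of the algebraic equation $$1=\Phi(z,t)\prod_{j=1}^{r}\big(z-\alpha_j t^\gamma\Phi(z,t)\big)$$ for which $z^r\Phi(z,t)\to1$ as $z\to\infty$.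
   Context: The limit $n\to\infty$, $n/N\to t$ means that $n\to\infty$ and $N=N(n)$ runs through positive integers in such a way that $n/N\to t$. *)

theory Defs
  imports
    "HOL-Complex_Analysis.Complex_Analysis"
    "HOL-Computational_Algebra.Polynomial"
    "HOL-Number_Theory.Cong"
begin

(* g n is the recurrence coefficient gamma_n; the exponent gamma is the separate real argument
   \<gamma> of Q below. *)
fun P :: "nat \<Rightarrow> (nat \<Rightarrow> real) \<Rightarrow> nat \<Rightarrow> complex poly" where
  "P r g n =
     (if n \<le> r then monom 1 n
      else [:0, 1:] * P r g (n - 1) - smult (complex_of_real (g (n - 1 - r))) (P r g (n - 1 - r)))"

(* The equation of P has no pattern matching, so as a simp rule it would loop. *)
declare P.simps [simp del]

lemma P_initial: "n \<le> r \<Longrightarrow> P r g n = monom 1 n"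
  by (simp add: P.simps)

lemma P_rec:
  "n \<ge> r \<Longrightarrow>
     P r g (n + 1) = [:0, 1:] * P r g n - smult (complex_of_real (g (n - r))) (P r g (n - r))"
  by (subst P.simps) simp

definition Q :: "nat \<Rightarrow> (nat \<Rightarrow> real) \<Rightarrow> real \<Rightarrow> nat \<Rightarrow> complex \<Rightarrow> nat \<Rightarrow> complex" where
  "Q r g \<gamma> n z N =
     complex_of_real (real N powr (- (real n * \<gamma> / real (r + 1)))) *
     poly (P r g n) (complex_of_real (real N powr (\<gamma> / real (r + 1))) * z)"

definition \<omega> :: "nat \<Rightarrow> complex" where
  "\<omega> m = exp (2 * complex_of_real pi * \<i> / of_nat m)"

definition star :: "nat \<Rightarrow> complex set" where
  "star r = (\<Union>k\<in>{0..r}. {complex_of_real x * \<omega> (r + 1) ^ k | x. x \<ge> 0})"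

end

theory Submission
  imports Defs "HOL-Real_Asymp.Real_Asymp"
begin

text \<open>
  Put \<open>x = - z\<^sup>r\<^sup>+\<^sup>1\<close>, which maps the complement of the star into the slit plane \<open>D\<close> (the plane
  without the nonpositive reals), and \<open>u\<^sub>n = Q\<^sub>n\<^sub>+\<^sub>1 / (z Q\<^sub>n)\<close>. The recurrence becomes
  \<open>u\<^sub>n = 1 + a\<^sub>n\<^sub>-\<^sub>r / (x u\<^sub>n\<^sub>-\<^sub>1 \<cdots> u\<^sub>n\<^sub>-\<^sub>r)\<close> with positive \<open>a\<close>. Writing \<open>arg u\<^sub>n = - \<theta>\<^sub>n arg x\<close>, one sees
  inductively that \<open>\<theta>\<^sub>n \<ge> 0\<close> and that the sum of any \<open>r + 1\<close> consecutive \<open>\<theta>\<close> is at most 1. Hence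
  \<open>u\<^sub>n\<close> has no zeros in \<open>D\<close> and is bounded away from 0 locally uniformly, independently of the
  coefficients, and the functions \<open>z\<^sup>r Q\<^sub>n / Q\<^sub>n\<^sub>+\<^sub>r = 1 / (u\<^sub>n \<cdots> u\<^sub>n\<^sub>+\<^sub>r\<^sub>-\<^sub>1)\<close> of \<open>x\<close> form a normal family.
  For large positive \<open>x\<close> the recurrence is a contraction that drives them to a root \<open>G\<close> of
  \<open>G (1 + c\<^sub>0 G/x) \<cdots> (1 + c\<^sub>r\<^sub>-\<^sub>1 G/x) = 1\<close> with \<open>c\<^sub>j = \<alpha>\<^sub>j\<^sub>+\<^sub>1 t\<^sup>\<gamma>\<close>; Vitali's theorem extends the
  convergence, and the identity theorem the equation, to all of \<open>D\<close>. Near infinity \<open>u\<^sub>n \<ge> 1/2\<close> in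
  modulus, so the limit is bounded there and the equation forces it to tend to 1.
\<close>

section \<open>Normalized consecutive ratios on the slit plane\<close>

text \<open>This is the ratio \<open>Q (n + 1) / (z * Q n)\<close>, expressed through
  \<open>x\<close> alone so that one slit plane serves all \<open>r + 1\<close> sectors of
  \<open>z\<close>. The initial value 1 reflects \<open>P r g n = monom 1 n\<close> for
  \<open>n \<le> r\<close>.\<close>

function nratio :: "nat \<Rightarrow> (nat \<Rightarrow> real) \<Rightarrow> complex \<Rightarrow> nat \<Rightarrow> complex" where
  "nratio r a x n =
     (if n < r then 1
      else 1 + complex_of_real (a (n - r)) / (x * (\<Prod>j\<in>{n - r..<n}. nratio r a x j)))"
  by pat_completeness auto
termination by (relation "Wellfounded.measure (\<lambda>(r, a, x, n). n)") auto

declare nratio.simps [simp del]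

lemma nratio_initial: "n < r \<Longrightarrow> nratio r a x n = 1"
  by (subst nratio.simps) simp

lemma nratio_rec:
  "n \<ge> r \<Longrightarrow> nratio r a x n = 1 + of_real (a (n - r)) / (x * (\<Prod>j\<in>{n - r..<n}. nratio r a x j))"
  by (subst nratio.simps) simp

section \<open>Argument and modulus of \<open>1 + y * cis \<phi>\<close>\<close>

lemma Arg_one_plus_cis:
  assumes "0 \<le> \<phi>" "\<phi> < pi" "y > 0"
  defines "u \<equiv> 1 + complex_of_real y * cis \<phi>"
  shows "u \<noteq> 0" "0 \<le> Arg u" "Arg u \<le> \<phi>"
proof -
  have "u \<noteq> 0 \<and> 0 \<le> Arg u \<and> Arg u \<le> \<phi>"
  proof (cases "\<phi> = 0")
    case True
    then have "u = of_real (1 + y)" by (simp add: u_def)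
    then show ?thesis using assms(3) True by (metis Arg_of_real add_pos_pos less_eq_real_def not_less of_real_eq_0_iff zero_less_one)
  next
    case False
    then have sin_pos: "sin \<phi> > 0" using assms by (intro sin_gt_zero) auto
    then have "Im u > 0" using \<open>y > 0\<close> by (simp add: u_def)
    then have A: "0 < Arg u" "Arg u < pi" "u \<noteq> 0" using Arg_lt_pi[of u] by auto
    \<comment> \<open>Rotating \<open>u\<close> by \<open>- \<phi>\<close> makes the summand
      \<open>y\<close> real, so the imaginary part becomes \<open>- sin \<phi> < 0\<close>. An
      argument exceeding \<open>\<phi>\<close> would make it positive.\<close>
    have "Arg u \<le> \<phi>"
    proof (rule ccontr)
      assume "\<not> Arg u \<le> \<phi>"
      then have "sin (Arg u - \<phi>) > 0" using assms A by (intro sin_gt_zero) auto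
      moreover have "u * cis (- \<phi>) = of_real (norm u) * cis (Arg u - \<phi>)"
        using rcis_cmod_Arg[of u] by (metis rcis_def cis_mult mult.assoc diff_conv_add_uminus)
      then have "norm u * sin (Arg u - \<phi>) = Im (u * cis (- \<phi>))" by simp
      moreover have "u * cis (- \<phi>) = cis (- \<phi>) + of_real y"
        by (simp add: u_def algebra_simps cis_mult)
      ultimately have "norm u * sin (Arg u - \<phi>) < 0" using sin_pos by simp
      then show False using \<open>sin (Arg u - \<phi>) > 0\<close>
        by (simp add: mult_less_0_iff)
    qed
    then show ?thesis using A by simp
  qed
  then show "u \<noteq> 0" "0 \<le> Arg u" "Arg u \<le> \<phi>" by auto
qed

text \<open>Angles are measured as fractions of a fixed \<open>\<delta>\<close> so that both signs
  of \<open>\<delta>\<close> are treated at once; complex conjugation reduces positive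
  \<open>\<delta>\<close> to the preceding lemma. For \<open>\<delta> = 0\<close> the fraction is
  undetermined and 0 is chosen.\<close>

lemma one_plus_cis_polar:
  assumes "0 \<le> \<beta>" "\<beta> \<le> 1" "\<bar>\<delta>\<bar> < pi" "y > 0"
  obtains \<rho> \<theta> where "\<rho> > 0" "0 \<le> \<theta>" "\<theta> \<le> \<beta>"
    "1 + of_real y * cis (- (\<beta> * \<delta>)) = of_real \<rho> * cis (- (\<theta> * \<delta>))"
proof (cases "\<delta> = 0")
  case True
  show ?thesis
    by (rule that[of "1 + y" 0]) (use True assms in auto)
next
  case False
  define \<phi> where "\<phi> = \<beta> * \<bar>\<delta>\<bar>"
  define v where "v = 1 + of_real y * cis \<phi>"
  have "\<phi> \<le> \<bar>\<delta>\<bar>" using assms by (simp add: \<phi>_def mult_left_le_one_le)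
  then have \<phi>: "0 \<le> \<phi>" "\<phi> < pi" using assms by (auto simp: \<phi>_def)
  note v = Arg_one_plus_cis[OF \<phi> \<open>y > 0\<close>, folded v_def]
  define \<theta> where "\<theta> = Arg v / \<bar>\<delta>\<bar>"
  have th: "\<theta> * \<bar>\<delta>\<bar> = Arg v" using False by (simp add: \<theta>_def)
  have \<theta>: "0 \<le> \<theta>" "\<theta> \<le> \<beta>" using v False by (auto simp: \<theta>_def \<phi>_def field_simps)
  have v_eq: "v = of_real (norm v) * cis (\<theta> * \<bar>\<delta>\<bar>)"
    using rcis_cmod_Arg[of v] th by (simp add: rcis_def)
  have "1 + of_real y * cis (- (\<beta> * \<delta>)) = of_real (norm v) * cis (- (\<theta> * \<delta>))"
  proof (cases "\<delta> > 0")
    case True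
    have "cnj v = cnj (of_real (norm v) * cis (\<theta> * \<bar>\<delta>\<bar>))" using v_eq by metis
    then show ?thesis using True by (simp add: v_def \<phi>_def cis_cnj)
  next
    case False
    then show ?thesis using v_eq by (simp add: v_def \<phi>_def)
  qed
  then show ?thesis using that[of "norm v" \<theta>] v(1) \<theta> by auto
qed

text \<open>The squared modulus is a combination of \<open>(1 + y)^2\<close> and
  \<open>(1 - y)^2\<close> with weights \<open>(1 + cos \<phi>) / 2\<close> and
  \<open>(1 - cos \<phi>) / 2\<close>. Dropping the second term and using
  \<open>1 + y \<ge> 1\<close> gives a bound free of \<open>y\<close>.\<close>

lemma norm_one_plus_cis_ge:
  assumes "y \<ge> 0" "\<bar>\<phi>\<bar> \<le> \<bar>\<delta>\<bar>" "\<bar>\<delta>\<bar> \<le> pi"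
  shows "(norm (1 + of_real y * cis \<phi>))\<^sup>2 \<ge> (1 + cos \<delta>) / 2"
proof -
  have "cos \<phi> \<ge> cos \<delta>"
    using cos_monotone_0_pi_le[of "\<bar>\<phi>\<bar>" "\<bar>\<delta>\<bar>"] assms by simp
  have "(norm (1 + of_real y * cis \<phi>))\<^sup>2 = 1 + 2 * y * cos \<phi> + y\<^sup>2 * ((sin \<phi>)\<^sup>2 + (cos \<phi>)\<^sup>2)"
    unfolding cmod_power2 by (simp del: sin_cos_squared_add sin_cos_squared_add2 sin_cos_squared_add3)
      (simp add: power2_eq_square algebra_simps del: sin_cos_squared_add sin_cos_squared_add2 sin_cos_squared_add3)
  also have "\<dots> = (1 + y)\<^sup>2 * ((1 + cos \<phi>) / 2) + (1 - y)\<^sup>2 * ((1 - cos \<phi>) / 2)"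
    by (simp add: power2_eq_square field_simps)
  also have "\<dots> \<ge> 1 * ((1 + cos \<phi>) / 2) + 0"
  proof (intro add_mono mult_right_mono)
    show "1 \<le> (1 + y)\<^sup>2" using assms by (simp add: one_le_power)
    show "0 \<le> (1 + cos \<phi>) / 2" proof -
      have "0 \<le> (1 + c) / 2" if "- 1 \<le> c" for c :: real using that by simp
      then show ?thesis using cos_ge_minus_one by blast
    qed
    show "0 \<le> (1 - y)\<^sup>2 * ((1 - cos \<phi>) / 2)" by simp
  qed
  finally show ?thesis using \<open>cos \<phi> \<ge> cos \<delta>\<close> by simp
qed

lemma prod_of_real_cis:
  "(\<Prod>j\<in>A. of_real (f j) * cis (h j)) = of_real (\<Prod>j\<in>A. f j) * cis (\<Sum>j\<in>A. h j)"
  by (induction A rule: infinite_finite_induct) (auto simp: mult_ac simp flip: cis_mult)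

text \<open>The angle bookkeeping: \<open>\<beta> = 1 - (\<theta>\<^sub>n\<^sub>-\<^sub>1 + \<cdots> + \<theta>\<^sub>n\<^sub>-\<^sub>r)\<close>, and adding a positive multiple of
  \<open>cis (- \<beta> Arg x)\<close> to 1 can only produce \<open>\<theta>\<^sub>n\<close> between 0 and \<open>\<beta>\<close>.\<close>

lemma nratio_polar:
  assumes x: "x \<notin> \<real>\<^sub>\<le>\<^sub>0" and a: "\<And>k. a k > 0"
  obtains \<beta> y where "0 \<le> \<beta>" "\<beta> \<le> 1" "y \<ge> 0"
    "nratio r a x n = 1 + of_real y * cis (- (\<beta> * Arg x))"
proof -
  define \<delta> where "\<delta> = Arg x"
  have x0: "x \<noteq> 0" using x by auto
  have \<delta>: "\<bar>\<delta>\<bar> < pi"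
    using x Arg_bounded[of x] Arg_eq_pi_iff[of x] by (auto simp: \<delta>_def abs_less_iff)
       (metis complex_is_Real_iff complex_nonpos_Reals_iff order_less_imp_le)
  have x_eq: "x = of_real (norm x) * cis \<delta>"
    using rcis_cmod_Arg[of x] by (simp add: rcis_def \<delta>_def)
  define \<theta> where "\<theta> = (\<lambda>k. if \<delta> = 0 then 0 else - Arg (nratio r a x k) / \<delta>)"
  define \<rho> where "\<rho> = (\<lambda>k. norm (nratio r a x k))"
  \<comment> \<open>The invariant of the induction. The window \<open>{k - r..k}\<close> has
    \<open>r + 1\<close> entries, or fewer when truncated at 0.\<close>
  define good where "good k \<longleftrightarrow> \<rho> k > 0 \<and> 0 \<le> \<theta> k \<and> (\<Sum>j\<in>{k - r..k}. \<theta> j) \<le> 1 \<and>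
     nratio r a x k = of_real (\<rho> k) * cis (- (\<theta> k * \<delta>))" for k
  \<comment> \<open>Kept separate from the induction because it serves twice: to propagate
    \<open>good\<close>, and to read off the representation claimed at the end.\<close>
  have step: "\<exists>\<beta> y. 0 \<le> \<beta> \<and> \<beta> \<le> 1 \<and> y \<ge> 0 \<and> \<beta> + (\<Sum>j\<in>{k - r..<k}. \<theta> j) \<le> 1 \<and>
     nratio r a x k = 1 + of_real y * cis (- (\<beta> * \<delta>))"
    if IH: "\<And>j. j < k \<Longrightarrow> good j" for k
  proof -
    define S where "S = (\<Sum>j\<in>{k - r..<k}. \<theta> j)"
    have "S \<ge> 0" unfolding S_def using IH by (intro sum_nonneg) (auto simp: good_def)
    have "S \<le> 1"
    proof (cases "k = 0")
      case False
      \<comment> \<open>The \<open>r\<close> indices before \<open>k\<close> lie in the full window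
        of \<open>k - 1\<close>, whose fractions are nonnegative with sum at most 1.\<close>
      then have "S \<le> (\<Sum>j\<in>{k - 1 - r..k - 1}. \<theta> j)"
        unfolding S_def using IH by (intro sum_mono2) (auto simp: good_def)
      also have "\<dots> \<le> 1" using IH[of "k - 1"] False by (simp add: good_def)
      finally show ?thesis .
    qed (simp add: S_def)
    show ?thesis
    proof (cases "k < r")
      case True
      then show ?thesis using \<open>S \<le> 1\<close>
        by (intro exI[of _ 0]) (simp add: nratio_initial S_def)
    next
      case False
      define R where "R = (\<Prod>j\<in>{k - r..<k}. \<rho> j)"
      have "R > 0" unfolding R_def using IH by (intro prod_pos) (auto simp: good_def)
      have "(\<Prod>j\<in>{k - r..<k}. nratio r a x j) =
          (\<Prod>j\<in>{k - r..<k}. of_real (\<rho> j) * cis (- (\<theta> j * \<delta>)))"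
        using IH by (intro prod.cong) (auto simp: good_def)
      also have "\<dots> = of_real R * cis (- (S * \<delta>))"
        unfolding prod_of_real_cis by (simp add: R_def S_def sum_negf sum_distrib_right)
      finally have "x * (\<Prod>j\<in>{k - r..<k}. nratio r a x j) =
          of_real (norm x * R) * cis ((1 - S) * \<delta>)"
        by (subst x_eq) (simp add: algebra_simps cis_mult)
      then have "nratio r a x k =
          1 + of_real (a (k - r)) / (of_real (norm x * R) * cis ((1 - S) * \<delta>))"
        using False by (subst nratio_rec) auto
      also have "\<dots> = 1 + of_real (a (k - r) / (norm x * R)) * cis (- ((1 - S) * \<delta>))"
        by (simp add: divide_inverse cis_inverse mult_ac)
      finally show ?thesis
        using \<open>S \<le> 1\<close> \<open>S \<ge> 0\<close> \<open>R > 0\<close> a[of "k - r"]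
        by (intro exI[of _ "1 - S"] exI[of _ "a (k - r) / (norm x * R)"])
           (simp add: S_def less_imp_le)
    qed
  qed
  have "good k" for k
  proof (induction k rule: less_induct)
    case (less k)
    then obtain \<beta> y where \<beta>: "0 \<le> \<beta>" "\<beta> \<le> 1" "y \<ge> 0"
      "\<beta> + (\<Sum>j\<in>{k - r..<k}. \<theta> j) \<le> 1"
      "nratio r a x k = 1 + of_real y * cis (- (\<beta> * \<delta>))" using step[of k] by auto
    obtain \<rho>' \<theta>' where \<theta>': "\<rho>' > 0" "0 \<le> \<theta>'" "\<theta>' \<le> \<beta>"
      "nratio r a x k = of_real \<rho>' * cis (- (\<theta>' * \<delta>))"
    proof (cases "y = 0")
      case True
      show ?thesis by (rule that[of 1 0]) (use True \<beta> in auto)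
    next
      case False
      then show ?thesis using one_plus_cis_polar[of \<beta> \<delta> y] \<beta> \<delta> that by auto
    qed
    have [simp]: "\<rho> k = \<rho>'" using \<theta>' by (simp add: \<rho>_def norm_mult)
    \<comment> \<open>Below \<open>pi\<close> in modulus, the angle found is the principal argument,
      so it agrees with the \<open>\<theta> k\<close> defined through \<open>Arg\<close>.\<close>
    have "\<bar>\<theta>' * \<delta>\<bar> < pi"
      using \<delta> \<theta>' \<beta> mult_left_le_one_le[of "\<bar>\<delta>\<bar>" \<theta>'] by (simp add: abs_mult)
    then have "Arg (nratio r a x k) = - (\<theta>' * \<delta>)"
      by (intro Arg_unique'[OF \<theta>'(1)]) (auto simp: \<theta>' rcis_def)
    then have "\<theta> k = (if \<delta> = 0 then 0 else \<theta>')" by (simp add: \<theta>_def)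
    moreover have "{k - r..k} = insert k {k - r..<k}" by auto
    ultimately show ?case using \<theta>' \<beta> by (auto simp: good_def)
  qed
  then obtain \<beta> y where "0 \<le> \<beta>" "\<beta> \<le> 1" "y \<ge> 0"
     "nratio r a x n = 1 + of_real y * cis (- (\<beta> * \<delta>))" using step[of n] by auto
  then show ?thesis using that by (auto simp: \<delta>_def)
qed

text \<open>The angle never exceeds that of \<open>x\<close>, whatever the coefficients. The bound
  therefore depends on \<open>x\<close> only, which yields normality for coefficients that vary with
  \<open>N\<close>.\<close>

lemma norm_nratio_ge:
  assumes "x \<notin> \<real>\<^sub>\<le>\<^sub>0" and "\<And>k. a k > 0"
  shows "(norm (nratio r a x n))\<^sup>2 \<ge> (1 + cos (Arg x)) / 2"
proof -
  obtain \<beta> y where *: "0 \<le> \<beta>" "\<beta> \<le> 1" "y \<ge> 0"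
    "nratio r a x n = 1 + of_real y * cis (- (\<beta> * Arg x))"
    using nratio_polar[OF assms] .
  have "\<bar>- (\<beta> * Arg x)\<bar> \<le> \<bar>Arg x\<bar>"
    using * by (simp add: abs_mult mult_left_le_one_le)
  then show ?thesis
    unfolding *(4) using *(3) Arg_bounded[of x] by (intro norm_one_plus_cis_ge) auto
qed

text \<open>Rewrites the bound as a visibly continuous function of \<open>x\<close>, so that it
  attains a minimum on compact sets.\<close>

lemma one_plus_cos_Arg:
  assumes "x \<noteq> 0"
  shows "1 + cos (Arg x) = 1 + Re x / norm x"
proof -
  have "Re (cis (Arg x)) = Re (sgn x)" using assms by (simp add: cis_Arg)
  then show ?thesis by (simp add: sgn_eq)
qed

lemma one_plus_Re_div_norm_pos:
  assumes "x \<notin> \<real>\<^sub>\<le>\<^sub>0"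
  shows "1 + Re x / norm x > 0"
proof -
  have x0: "x \<noteq> 0" using assms by auto
  have "- norm x < Re x"
  proof (cases "Re x > 0")
    case False
    then have "Im x \<noteq> 0" using assms by (auto simp: complex_nonpos_Reals_iff)
    then have "(Re x)\<^sup>2 < (norm x)\<^sup>2" by (simp add: cmod_power2)
    then have "\<bar>Re x\<bar> < norm x" by (auto intro: power2_less_imp_less)
    then show ?thesis by linarith
  qed (use norm_ge_zero[of x] in linarith)
  then show ?thesis using x0 by (simp add: field_simps)
qed

lemma nratio_nonzero:
  assumes "x \<notin> \<real>\<^sub>\<le>\<^sub>0" and "\<And>k. a k > 0"
  shows "nratio r a x n \<noteq> 0"
proof -
  have "x \<noteq> 0" using assms by auto
  then have "(norm (nratio r a x n))\<^sup>2 > 0"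
    using norm_nratio_ge[of x a r n] assms(2) one_plus_Re_div_norm_pos[of x] assms(1) one_plus_cos_Arg[of x]
    by force
  then show ?thesis by auto
qed

lemma norm_nratio_ge_1:
  assumes "x > 0" and "\<And>k. a k > 0"
  shows "norm (nratio r a (of_real x) n) \<ge> 1"
proof -
  have "(norm (nratio r a (of_real x) n))\<^sup>2 \<ge> 1"
    using norm_nratio_ge[of "of_real x" a r n] assms by (simp add: Arg_of_real)
  then show ?thesis by (auto intro: power2_le_imp_le)
qed

lemma holomorphic_nratio:
  assumes "\<And>k. a k > 0"
  shows "(\<lambda>x. nratio r a x n) holomorphic_on - \<real>\<^sub>\<le>\<^sub>0"
proof (induction n rule: less_induct)
  case (less n)
  show ?case
  proof (cases "n < r")
    case True
    then show ?thesis by (simp add: nratio_initial)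
  next
    case False
    then have "(\<lambda>x. nratio r a x n) =
        (\<lambda>x. 1 + of_real (a (n - r)) / (x * (\<Prod>j\<in>{n - r..<n}. nratio r a x j)))"
      by (intro ext nratio_rec) simp
    moreover have "\<dots> holomorphic_on - \<real>\<^sub>\<le>\<^sub>0"
      by (intro holomorphic_intros less) (auto simp: nratio_nonzero assms)
    ultimately show ?thesis by simp
  qed
qed

text \<open>As a function of \<open>x = - z^(r+1)\<close> this is
  \<open>z^r * Q n / Q (n + r)\<close>, the quantity whose limit is sought.\<close>

definition block_ratio :: "nat \<Rightarrow> (nat \<Rightarrow> real) \<Rightarrow> nat \<Rightarrow> complex \<Rightarrow> complex" where
  "block_ratio r a n x = inverse (\<Prod>j\<in>{n..<n + r}. nratio r a x j)"

lemma holomorphic_block_ratio: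
  assumes "\<And>k. a k > 0"
  shows "block_ratio r a n holomorphic_on - \<real>\<^sub>\<le>\<^sub>0"
  unfolding block_ratio_def[abs_def]
  using assms by (auto intro!: holomorphic_intros holomorphic_nratio simp: nratio_nonzero)

lemma norm_block_ratio_le:
  assumes "c > 0" and "\<And>j. j \<in> {n..<n + r} \<Longrightarrow> norm (nratio r a x j) \<ge> c"
  shows "norm (block_ratio r a n x) \<le> (1 / c) ^ r"
proof -
  have "norm (block_ratio r a n x) = (\<Prod>j\<in>{n..<n + r}. inverse (norm (nratio r a x j)))"
    by (simp add: block_ratio_def norm_inverse prod_norm[symmetric] prod_inversef[symmetric] o_def)
  also have "\<dots> \<le> (\<Prod>j\<in>{n..<n + r}. 1 / c)"
    using assms by (intro prod_mono) (auto simp: divide_inverse intro!: le_imp_inverse_le)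
  finally show ?thesis by simp
qed

text \<open>The lower bound for the ratios attains a positive minimum on \<open>K\<close>. The
  quantifier over \<open>a\<close> stands inside that over \<open>B\<close> because the coefficient
  sequence changes along the limit.\<close>

lemma block_ratio_locally_bounded:
  assumes "compact K" "K \<subseteq> - \<real>\<^sub>\<le>\<^sub>0"
  shows "\<exists>B. \<forall>a n. (\<forall>k. a k > 0) \<longrightarrow> (\<forall>x\<in>K. norm (block_ratio r a n x) \<le> B)"
proof (cases "K = {}")
  case False
  have "continuous_on K (\<lambda>x. 1 + Re x / norm x)"
    using assms by (intro continuous_intros) auto
  then obtain x0 where x0: "x0 \<in> K" "\<And>x. x \<in> K \<Longrightarrow> 1 + Re x0 / norm x0 \<le> 1 + Re x / norm x"
    using continuous_attains_inf[OF assms(1) False] by blast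
  define c where "c = sqrt ((1 + Re x0 / norm x0) / 2)"
  have "c > 0" using one_plus_Re_div_norm_pos[of x0] x0(1) assms(2) by (auto simp: c_def)
  moreover have "c \<le> norm (nratio r a x j)" if "\<forall>k. a k > 0" "x \<in> K" for a x j
  proof -
    have x: "x \<notin> \<real>\<^sub>\<le>\<^sub>0" "x \<noteq> 0" using that assms(2) by auto
    have "(1 + Re x0 / norm x0) / 2 \<le> (norm (nratio r a x j))\<^sup>2"
      using norm_nratio_ge[of x a r j] x that x0(2)[of x] by (simp add: one_plus_cos_Arg)
    then show ?thesis unfolding c_def by (intro real_le_lsqrt) auto
  qed
  ultimately show ?thesis
    by (intro exI[of _ "(1 / c) ^ r"] allI impI ballI norm_block_ratio_le) auto
qed simp

section \<open>Vitali's theorem and the contraction for large positive arguments\<close>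

lemma holomorphic_eq_on_connected:
  assumes "f holomorphic_on S" "g holomorphic_on S" "open S" "connected S"
    and "A \<subseteq> S" "\<xi> \<in> S" "\<xi> islimpt A" "\<And>x. x \<in> A \<Longrightarrow> f x = g x" "w \<in> S"
  shows "f w = g w"
proof -
  have "(\<lambda>z. f z - g z) holomorphic_on S" using assms by (intro holomorphic_intros)
  from analytic_continuation[OF this assms(3-7) _ assms(9)] assms(8) show ?thesis by simp
qed

text \<open>By Montel, every subsequence has a further one converging locally uniformly. All these
  limits equal \<open>G\<close> on \<open>A\<close>, hence coincide on \<open>S\<close> by the
  identity theorem, which forces convergence of the whole sequence.\<close>

lemma vitali_convergence:
  fixes f :: "nat \<Rightarrow> complex \<Rightarrow> complex"
  assumes S: "open S" "connected S"
    and holf: "\<And>m. f m holomorphic_on S"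
    and bounded: "\<And>K. compact K \<Longrightarrow> K \<subseteq> S \<Longrightarrow> \<exists>B. \<forall>m. \<forall>x\<in>K. norm (f m x) \<le> B"
    and A: "A \<subseteq> S" "\<xi> \<in> S" "\<xi> islimpt A"
    and lim: "\<And>x. x \<in> A \<Longrightarrow> (\<lambda>m. f m x) \<longlonglongrightarrow> G x"
  obtains F where "F holomorphic_on S" "\<And>x. x \<in> A \<Longrightarrow> F x = G x"
    "\<And>K. compact K \<Longrightarrow> K \<subseteq> S \<Longrightarrow> uniform_limit K f F sequentially"
proof -
  have sub: "\<exists>F s'. F holomorphic_on S \<and> strict_mono s' \<and> (\<forall>x\<in>A. F x = G x) \<and>
      (\<forall>K. compact K \<longrightarrow> K \<subseteq> S \<longrightarrow> uniform_limit K (\<lambda>n. f (s (s' n))) F sequentially)"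
    if s: "strict_mono s" for s :: "nat \<Rightarrow> nat"
  proof -
    have bounded': "\<exists>B. \<forall>h\<in>range f. \<forall>z\<in>K. norm (h z) \<le> B" if "compact K" "K \<subseteq> S" for K
      using bounded[OF that] by simp
    have rng: "range (\<lambda>n. f (s n)) \<subseteq> range f" by auto
    obtain F s' where F: "F holomorphic_on S" "strict_mono (s' :: nat \<Rightarrow> nat)"
      "\<And>x. x \<in> S \<Longrightarrow> (\<lambda>n. f (s (s' n)) x) \<longlonglongrightarrow> F x"
      "\<And>K. compact K \<Longrightarrow> K \<subseteq> S \<Longrightarrow> uniform_limit K ((\<lambda>n. f (s n)) \<circ> s') F sequentially"
      by (rule Montel[OF S(1) _ bounded' rng]) (use holf in \<open>blast+\<close>)
    have "F x = G x" if "x \<in> A" for x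
    proof -
      have "(\<lambda>n. f (s (s' n)) x) \<longlonglongrightarrow> G x"
        using LIMSEQ_subseq_LIMSEQ[OF lim[OF that], of "s \<circ> s'"] strict_mono_o[OF s F(2)]
        by (simp add: o_def)
      then show ?thesis using F(3)[of x] that A(1) LIMSEQ_unique by blast
    qed
    then show ?thesis using F by (auto simp: o_def)
  qed
  obtain F where F: "F holomorphic_on S" "\<forall>x\<in>A. F x = G x"
    using sub[of "\<lambda>n. n"] by (auto simp: strict_mono_def)
  have "uniform_limit K f F sequentially" if K: "compact K" "K \<subseteq> S" for K
  proof (rule ccontr)
    assume "\<not> ?thesis"
    then obtain e where e: "e > 0" and "\<And>N. \<exists>n\<ge>N. \<exists>x\<in>K. dist (f n x) (F x) \<ge> e"
      unfolding uniform_limit_sequentially_iff by (meson linorder_not_less)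
    \<comment> \<open>If uniform convergence fails, the bad indices form a subsequence. One of its
      subsequences converges uniformly on \<open>K\<close> to a function equal to \<open>F\<close>,
      a contradiction.\<close>
    then have inf: "infinite {n. \<exists>x\<in>K. dist (f n x) (F x) \<ge> e}" (is "infinite ?I")
      unfolding infinite_nat_iff_unbounded_le by auto
    define s where "s = enumerate ?I"
    have s: "strict_mono s" "\<And>n. s n \<in> ?I"
      using inf enumerate_in_set[OF inf] unfolding s_def by (auto simp: strict_mono_enumerate)
    obtain F' s' where F': "F' holomorphic_on S" "\<forall>x\<in>A. F' x = G x"
        "uniform_limit K (\<lambda>n. f (s (s' n))) F' sequentially"
      using sub[OF s(1)] K by blast
    have "F' x = F x" if "x \<in> S" for x
      using holomorphic_eq_on_connected[OF F'(1) F(1) S A _ that] F(2) F'(2) by auto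
    then have eq: "F' x = F x" if "x \<in> K" for x using that K(2) by auto
    have "\<forall>\<^sub>F n in sequentially. \<forall>x\<in>K. dist (f (s (s' n)) x) (F' x) < e"
      using F'(3) e unfolding uniform_limit_iff by blast
    then have "\<forall>\<^sub>F n in sequentially. \<forall>x\<in>K. dist (f (s (s' n)) x) (F x) < e"
      by eventually_elim (simp add: eq)
    then obtain n where "\<forall>x\<in>K. dist (f (s (s' n)) x) (F x) < e"
      by (auto simp: eventually_sequentially)
    then show False using s(2)[of "s' n"] by fastforce
  qed
  then show ?thesis using that F by blast
qed

section \<open>Contraction towards the periodic solution for large positive arguments\<close>

lemma prod_periodic_block:
  fixes f :: "nat \<Rightarrow> 'a :: comm_monoid_mult"
  assumes "r \<ge> 1" "\<And>k. f (k + r) = f k"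
  shows "(\<Prod>j\<in>{k..<k + r}. f j) = (\<Prod>j\<in>{0..<r}. f j)"
proof (induction k)
  case (Suc k)
  have "(\<Prod>j\<in>{Suc k..<Suc k + r}. f j) = (\<Prod>j\<in>{Suc k..<k + r}. f j) * f (k + r)"
    using assms(1) by (simp add: prod.atLeastLessThan_Suc)
  also have "\<dots> = (\<Prod>j\<in>{k..<k + r}. f j)"
    using assms by (simp add: prod.atLeast_Suc_lessThan[of k "k + r"] mult.commute)
  finally show ?case using Suc by simp
qed simp

lemma norm_inverse_diff_le:
  fixes a b :: "'a :: real_normed_field"
  assumes "norm a \<ge> 1" "norm b \<ge> 1"
  shows "norm (inverse a - inverse b) \<le> norm (a - b)"
proof -
  have "a \<noteq> 0" "b \<noteq> 0" using assms by auto
  then have "norm (inverse a - inverse b) = inverse (norm a) * norm (a - b) * inverse (norm b)"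
    by (simp add: inverse_diff_inverse norm_mult norm_inverse)
  also have "\<dots> \<le> 1 * norm (a - b) * 1"
    using assms by (intro mult_mono) (auto simp: inverse_le_1_iff)
  finally show ?thesis by simp
qed

text \<open>Intermediate value theorem: the left side is 0 at \<open>G = 0\<close> and at least 1 at
  \<open>G = 1\<close>.\<close>

lemma fixed_point_equation_solvable:
  fixes x :: real
  assumes "x > 0" "\<And>k. c k \<ge> 0"
  obtains G where "0 \<le> G" "G \<le> 1" "G * (\<Prod>j\<in>{0..<r}. 1 + c j * G / x) = 1"
proof -
  have "\<exists>G\<ge>0. G \<le> 1 \<and> G * (\<Prod>j\<in>{0..<r}. 1 + c j * G / x) = 1"
  proof (rule IVT')
    show "1 \<le> 1 * (\<Prod>j\<in>{0..<r}. 1 + c j * 1 / x)"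
      using assms by (auto intro!: prod_ge_1)
    show "continuous_on {0..1} (\<lambda>G. G * (\<Prod>j\<in>{0..<r}. 1 + c j * G / x))"
      using assms by (intro continuous_intros) auto
  qed auto
  then show ?thesis using that by blast
qed

text \<open>Row \<open>m\<close> of \<open>b\<close> is close to the periodic \<open>c\<close> only
  at bounded distance from the diagonal; further back it is merely bounded. That suffices because
  \<open>x \<ge> 2 * r * M\<close> makes the recurrence halve errors, so distant values are
  forgotten.\<close>

lemma block_ratio_tendsto_fixed_point:
  fixes b :: "nat \<Rightarrow> nat \<Rightarrow> real" and c :: "nat \<Rightarrow> real"
  assumes r: "r \<ge> 1" and b_pos: "\<And>m k. b m k > 0" and b_le: "\<And>m k. k \<le> m \<Longrightarrow> b m k \<le> M"
    and c: "\<And>k. 0 \<le> c k" "\<And>k. c k \<le> M" "\<And>k. c (k + r) = c k"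
    and lim: "\<And>j. (\<lambda>m. b m (m - j) - c (m - j)) \<longlonglongrightarrow> 0"
    and x: "x \<ge> 2 * real r * M"
    and G: "0 \<le> G" "G \<le> 1" "G * (\<Prod>j\<in>{0..<r}. 1 + c j * G / x) = 1"
  shows "(\<lambda>m. block_ratio r (b m) m (of_real x)) \<longlonglongrightarrow> of_real G"
proof -
  have "M > 0" using b_pos[of 0 0] b_le[of 0 0] by simp
  have "1 * M \<le> real r * M" using r \<open>M > 0\<close> by (intro mult_right_mono) auto
  then have xM: "2 * M \<le> x" using x by linarith
  then have "x > 0" using \<open>M > 0\<close> by linarith
  define u where "u m k = nratio r (b m) (of_real x) k" for m k
  \<comment> \<open>The \<open>r\<close>-periodic exact solution of the recurrence with coefficients
    \<open>c\<close>: by the equation for \<open>G\<close>, the inverse product over any period is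
    \<open>G\<close>.\<close>
  define us where "us k = complex_of_real (1 + c k * G / x)" for k
  define d where "d m k = norm (u m k - us k)" for m k
  have us_ge: "norm (us k) \<ge> 1" for k
  proof -
    have "c k * G / x \<ge> 0" using c(1)[of k] G(1) \<open>x > 0\<close> by simp
    then show ?thesis unfolding us_def norm_of_real by simp
  qed
  have us_le: "norm (us k) \<le> 3 / 2" for k
  proof -
    have "c k * G \<le> M * 1" using c(1,2)[of k] G by (intro mult_mono) auto
    then have "c k * G / x \<le> 1 / 2" using xM \<open>x > 0\<close> by (simp add: field_simps)
    moreover have "c k * G / x \<ge> 0" using c(1)[of k] G(1) \<open>x > 0\<close> by simp
    ultimately show ?thesis unfolding us_def norm_of_real by simp
  qed
  have u_ge: "norm (u m k) \<ge> 1" for m k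
    unfolding u_def using norm_nratio_ge_1[OF \<open>x > 0\<close>] b_pos by blast
  have u_rec: "u m (k + r) = 1 + of_real (b m k / x) * (\<Prod>j\<in>{k..<k + r}. inverse (u m j))" for m k
    unfolding u_def by (subst nratio_rec)
      (auto simp: divide_inverse prod_inversef[symmetric] o_def mult_ac)
  have us_prod: "(\<Prod>j\<in>{k..<k + r}. inverse (us j)) = of_real G" for k
  proof -
    have "(\<Prod>j\<in>{k..<k + r}. us j) = (\<Prod>j\<in>{0..<r}. us j)"
      using r by (intro prod_periodic_block) (auto simp: us_def c(3))
    also have "\<dots> = of_real (\<Prod>j\<in>{0..<r}. 1 + c j * G / x)" by (simp add: us_def)
    also have "\<dots> = inverse (of_real G)"
      using inverse_unique[OF G(3)] by (simp flip: of_real_inverse)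
    finally show ?thesis using prod_inversef[of us "{k..<k + r}"] by (simp add: o_def)
  qed
  have us_rec: "us (k + r) = 1 + of_real (c k / x) * (\<Prod>j\<in>{k..<k + r}. inverse (us j))" for k
    by (simp add: us_prod) (simp add: us_def c(3))
  have prod_le: "norm (\<Prod>j\<in>J. inverse (u m j)) \<le> 1" for J m
    unfolding prod_norm[symmetric] using u_ge
    by (intro prod_le_1) (auto simp: norm_inverse inverse_le_1_iff)
  \<comment> \<open>The difference splits into a coefficient error and a product error. All factors
    have modulus at least 1, so inversion and multiplication do not enlarge differences.\<close>
  have d_rec: "d m (k + r) \<le> \<bar>b m k - c k\<bar> / x + M / x * (\<Sum>j\<in>{k..<k + r}. d m j)" for m k
  proof -
    let ?W = "\<Prod>j\<in>{k..<k + r}. inverse (u m j)" and ?Ws = "\<Prod>j\<in>{k..<k + r}. inverse (us j)"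
    have "u m (k + r) - us (k + r) = of_real ((b m k - c k) / x) * ?W + of_real (c k / x) * (?W - ?Ws)"
      by (simp add: u_rec us_rec diff_divide_distrib algebra_simps)
    then have "d m (k + r) \<le> norm (of_real ((b m k - c k) / x) * ?W) + norm (of_real (c k / x) * (?W - ?Ws))"
      unfolding d_def by (simp only: norm_triangle_ineq)
    also have "\<dots> = \<bar>b m k - c k\<bar> / x * norm ?W + c k / x * norm (?W - ?Ws)"
      unfolding norm_mult norm_of_real using \<open>x > 0\<close> c(1)[of k] by (simp add: abs_divide)
    also have "\<dots> \<le> \<bar>b m k - c k\<bar> / x * 1 + M / x * (\<Sum>j\<in>{k..<k + r}. d m j)"
    proof (intro add_mono mult_mono prod_le)
      have "norm (?W - ?Ws) \<le> (\<Sum>j\<in>{k..<k + r}. norm (inverse (u m j) - inverse (us j)))"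
        using u_ge us_ge by (intro norm_prod_diff) (auto simp: norm_inverse inverse_le_1_iff)
      also have "\<dots> \<le> (\<Sum>j\<in>{k..<k + r}. d m j)"
        unfolding d_def using u_ge us_ge by (intro sum_mono norm_inverse_diff_le) auto
      finally show "norm (?W - ?Ws) \<le> (\<Sum>j\<in>{k..<k + r}. d m j)" .
    qed (use \<open>x > 0\<close> c[of k] \<open>M > 0\<close> in \<open>auto simp: divide_right_mono\<close>)
    finally show ?thesis by simp
  qed
  \<comment> \<open>Both moduli are at most \<open>3 / 2\<close>; their sum 3 starts the halving
    argument.\<close>
  have d_le: "d m (k + r) \<le> 3" if "k \<le> m" for m k
  proof -
    have "b m k / x \<le> 1 / 2" using b_le[OF that] xM \<open>x > 0\<close> by (simp add: field_simps)
    then have "b m k / x * norm (\<Prod>j\<in>{k..<k + r}. inverse (u m j)) \<le> 1 / 2 * 1"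
      by (intro mult_mono prod_le) auto
    then have "norm (u m (k + r)) \<le> 1 + 1 / 2"
      unfolding u_rec using \<open>x > 0\<close> b_pos[of m k]
      by (intro order_trans[OF norm_triangle_ineq]) (simp add: norm_mult norm_divide)
    then show ?thesis
      using norm_triangle_ineq4[of "u m (k + r)" "us (k + r)"] us_le[of "k + r"]
      unfolding d_def by linarith
  qed
  \<comment> \<open>Each of the \<open>p\<close> halvings looks back up to \<open>r\<close> indices,
    so the offset \<open>j\<close> must stay arbitrary in the induction. Half of \<open>e\<close>
    pays for the coefficient error, the other half comes from the halved slack.\<close>
  have claim: "\<forall>\<^sub>F m in sequentially. d m (m + r - j) \<le> 3 / 2 ^ p + e" if "e > 0" for p j e
    using that
  proof (induction p arbitrary: j e)
    case 0
    have "\<forall>\<^sub>F m in sequentially. m \<ge> j" by (rule eventually_ge_at_top)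
    then show ?case
    proof eventually_elim
      case (elim m)
      then show ?case using d_le[of "m - j" m] 0 by simp
    qed
  next
    case (Suc p)
    have "\<forall>\<^sub>F m in sequentially. \<bar>b m (m - j) - c (m - j)\<bar> < e / 2 * x"
      using tendstoD[OF lim[of j], of "e / 2 * x"] Suc.prems \<open>x > 0\<close> by (simp add: dist_norm)
    moreover have "\<forall>\<^sub>F m in sequentially. \<forall>i\<in>{1..r}. d m (m + r - (j + i)) \<le> 3 / 2 ^ p + e"
      using Suc by (intro eventually_ball_finite) auto
    moreover have "\<forall>\<^sub>F m in sequentially. m \<ge> j" by (rule eventually_ge_at_top)
    ultimately show ?case
    proof eventually_elim
      case (elim m)
      define k where "k = m - j"
      have k: "m + r - j = k + r" using elim(3) by (simp add: k_def)
      have "d m i \<le> 3 / 2 ^ p + e" if "i \<in> {k..<k + r}" for i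
      proof -
        have "k + r - i \<in> {1..r}" "m + r - (j + (k + r - i)) = i"
          using that elim(3) by (auto simp: k_def)
        then show ?thesis using elim(2) by metis
      qed
      then have "(\<Sum>i\<in>{k..<k + r}. d m i) \<le> real r * (3 / 2 ^ p + e)"
        using sum_bounded_above[of "{k..<k + r}" "d m"] by simp
      then have "M / x * (\<Sum>i\<in>{k..<k + r}. d m i) \<le> M / x * (real r * (3 / 2 ^ p + e))"
        using \<open>M > 0\<close> \<open>x > 0\<close> by (intro mult_left_mono) auto
      also have "\<dots> = (real r * M / x) * (3 / 2 ^ p + e)" by simp
      also have "\<dots> \<le> 1 / 2 * (3 / 2 ^ p + e)"
        using x \<open>x > 0\<close> Suc.prems by (intro mult_right_mono) (auto simp: field_simps intro: add_nonneg_nonneg)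
      also have "\<dots> = 3 / 2 ^ Suc p + e / 2" by (simp add: field_simps)
      finally have "M / x * (\<Sum>i\<in>{k..<k + r}. d m i) \<le> 3 / 2 ^ Suc p + e / 2" .
      moreover have "\<bar>b m k - c k\<bar> / x \<le> e / 2"
        using elim(1) \<open>x > 0\<close> by (simp add: k_def field_simps)
      ultimately show ?case unfolding k using d_rec[of m k] by linarith
    qed
  qed
  have d_lim: "(\<lambda>m. d m (m + r - j)) \<longlonglongrightarrow> 0" for j
  proof (rule tendstoI)
    fix e :: real assume "e > 0"
    then obtain p where "(1 / 2) ^ p < e / 2 / 3"
      using real_arch_pow_inv[of "e / 2 / 3" "1 / 2"] by auto
    then have p: "3 / 2 ^ p < e / 2" by (simp add: power_one_over field_simps)
    have "\<forall>\<^sub>F m in sequentially. d m (m + r - j) \<le> 3 / 2 ^ p + e / 2"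
      using claim[of "e / 2"] \<open>e > 0\<close> by simp
    then show "\<forall>\<^sub>F m in sequentially. dist (d m (m + r - j)) 0 < e"
      by eventually_elim (use p in \<open>simp add: d_def\<close>)
  qed
  have "(\<lambda>m. \<Sum>i\<in>{0..<r}. d m (m + r - (r - i))) \<longlonglongrightarrow> (\<Sum>i\<in>{0..<r}. 0)"
    by (intro tendsto_sum d_lim)
  then have sum_lim: "(\<lambda>m. \<Sum>j\<in>{m..<m + r}. d m j) \<longlonglongrightarrow> 0"
  proof -
    have "(\<Sum>j\<in>{m..<m + r}. d m j) = (\<Sum>i\<in>{0..<r}. d m (m + r - (r - i)))" for m
      by (rule sum.reindex_bij_witness[of _ "\<lambda>i. i + m" "\<lambda>j. j - m"]) auto
    then show ?thesis using \<open>_ \<longlonglongrightarrow> (\<Sum>i\<in>{0..<r}. 0)\<close> by simp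
  qed
  have "norm (block_ratio r (b m) m (of_real x) - of_real G) \<le> (\<Sum>j\<in>{m..<m + r}. d m j)" for m
  proof -
    have "block_ratio r (b m) m (of_real x) - of_real G =
        (\<Prod>j\<in>{m..<m + r}. inverse (u m j)) - (\<Prod>j\<in>{m..<m + r}. inverse (us j))"
      by (simp add: us_prod) (simp add: block_ratio_def u_def prod_inversef[symmetric] o_def)
    also have "norm \<dots> \<le> (\<Sum>j\<in>{m..<m + r}. norm (inverse (u m j) - inverse (us j)))"
      using u_ge us_ge by (intro norm_prod_diff) (auto simp: norm_inverse inverse_le_1_iff)
    also have "\<dots> \<le> (\<Sum>j\<in>{m..<m + r}. d m j)"
      unfolding d_def using u_ge us_ge by (intro sum_mono norm_inverse_diff_le) auto
    finally show ?thesis .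
  qed
  then have "(\<lambda>m. block_ratio r (b m) m (of_real x) - of_real G) \<longlonglongrightarrow> 0"
    by (intro Lim_null_comparison[OF _ sum_lim]) auto
  then show ?thesis by (rule LIM_zero_cancel)
qed

section \<open>The limit function\<close>

lemma open_slit: "open (- (\<real>\<^sub>\<le>\<^sub>0 :: complex set))"
  by (simp add: open_Compl)

lemma connected_slit: "connected (- (\<real>\<^sub>\<le>\<^sub>0 :: complex set))"
proof -
  have "(\<real>\<^sub>\<le>\<^sub>0 :: complex set) = complex_of_real ` {..0}"
    by (auto simp: nonpos_Reals_def)
  then show ?thesis
    using starlike_imp_connected[OF starlike_slotted_complex_plane_left[of 0]] by simp
qed

lemma islimpt_of_real_atLeast: "complex_of_real X islimpt of_real ` {X..}"
  unfolding islimpt_approachable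
proof (intro allI impI)
  fix e :: real assume "e > 0"
  then show "\<exists>x'\<in>complex_of_real ` {X..}. x' \<noteq> of_real X \<and> dist x' (of_real X) < e"
    by (intro bexI[of _ "of_real (X + e / 2)"] imageI) (auto simp: dist_norm)
qed

lemma slit_identity:
  assumes "f holomorphic_on - \<real>\<^sub>\<le>\<^sub>0" "g holomorphic_on - \<real>\<^sub>\<le>\<^sub>0" "X > 0"
    and "\<And>x. x \<ge> X \<Longrightarrow> f (complex_of_real x) = g (of_real x)" and "w \<in> - \<real>\<^sub>\<le>\<^sub>0"
  shows "f w = g w"
proof (rule holomorphic_eq_on_connected[OF assms(1,2) open_slit connected_slit _ _ islimpt_of_real_atLeast])
  show "complex_of_real ` {X..} \<subseteq> - \<real>\<^sub>\<le>\<^sub>0" "complex_of_real X \<in> - \<real>\<^sub>\<le>\<^sub>0"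
    using assms(3) by auto
  fix x assume "x \<in> complex_of_real ` {X..}"
  then obtain y where "x = of_real y" "y \<ge> X" by auto
  then show "f x = g x" using assms(4)[of y] by simp
qed (rule assms(5))

text \<open>The angle bound degenerates at the slit, whereas this one is uniform over all directions
  near infinity. If the \<open>r\<close> preceding ratios are at least \<open>1 / 2\<close>, the
  perturbation of 1 is at most \<open>M * 2^r / norm x \<le> 1 / 2\<close>. The range
  \<open>n \<le> m + r\<close> keeps the coefficient index \<open>n - r\<close> within
  \<open>m\<close>.\<close>

lemma norm_nratio_ge_half:
  assumes "\<And>k. k \<le> m \<Longrightarrow> \<bar>a k\<bar> \<le> M" "M > 0" "norm x \<ge> 2 ^ (r + 1) * M" "n \<le> m + r"
  shows "norm (nratio r a x n) \<ge> 1 / 2"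
  using assms(4)
proof (induction n rule: less_induct)
  case (less n)
  show ?case
  proof (cases "n < r")
    case False
    have x: "norm x > 0" using assms(2,3) by (smt (verit) mult_pos_pos zero_less_power)
    let ?p = "norm (\<Prod>j\<in>{n - r..<n}. nratio r a x j)"
    have "(\<Prod>j\<in>{n - r..<n}. 1 / 2) \<le> (\<Prod>j\<in>{n - r..<n}. norm (nratio r a x j))"
      using less by (intro prod_mono) auto
    then have p: "?p \<ge> (1 / 2) ^ r" using False by (simp add: prod_norm)
    have "2 * M \<le> norm x * (1 / 2) ^ r"
      using assms(3) by (simp add: power_one_over field_simps)
    also have "\<dots> \<le> norm x * ?p" using p x by (intro mult_left_mono) auto
    finally have "M / (norm x * ?p) \<le> 1 / 2"
      using assms(2) by (simp add: field_simps)
    moreover have "\<bar>a (n - r)\<bar> / (norm x * ?p) \<le> M / (norm x * ?p)"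
      using assms(1)[of "n - r"] less.prems by (intro divide_right_mono) auto
    moreover have "norm (nratio r a x n) \<ge> norm (1 :: complex) - \<bar>a (n - r)\<bar> / (norm x * ?p)"
      using False norm_diff_ineq[of 1 "of_real (a (n - r)) / (x * (\<Prod>j\<in>{n - r..<n}. nratio r a x j))"]
      by (subst nratio_rec) (auto simp: norm_divide norm_mult)
    ultimately show ?thesis unfolding norm_one by linarith
  qed (simp add: nratio_initial)
qed

text \<open>A fixed choice depending only on \<open>r\<close>, \<open>c\<close> and
  \<open>x\<close>, so that limits obtained along different \<open>N\<close> take the same values on
  a ray.\<close>

definition fixpoint :: "nat \<Rightarrow> (nat \<Rightarrow> real) \<Rightarrow> real \<Rightarrow> real" where
  "fixpoint r c x = (SOME G. 0 \<le> G \<and> G \<le> 1 \<and> G * (\<Prod>j\<in>{0..<r}. 1 + c j * G / x) = 1)"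

lemma fixpoint:
  assumes "x > 0" "\<And>k. c k \<ge> 0"
  shows "0 \<le> fixpoint r c x" "fixpoint r c x \<le> 1"
    "fixpoint r c x * (\<Prod>j\<in>{0..<r}. 1 + c j * fixpoint r c x / x) = 1"
proof -
  let ?P = "\<lambda>G. 0 \<le> G \<and> G \<le> 1 \<and> G * (\<Prod>j\<in>{0..<r}. 1 + c j * G / x) = 1"
  obtain G where "0 \<le> G" "G \<le> 1" "G * (\<Prod>j\<in>{0..<r}. 1 + c j * G / x) = 1"
    by (rule fixed_point_equation_solvable[OF assms])
  then have "?P G" by (intro conjI)
  then have "?P (fixpoint r c x)" unfolding fixpoint_def by (rule someI[of ?P])
  note * = this
  show "0 \<le> fixpoint r c x" by (rule conjunct1[OF *])
  show "fixpoint r c x \<le> 1" by (rule conjunct1[OF conjunct2[OF *]])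
  show "fixpoint r c x * (\<Prod>j\<in>{0..<r}. 1 + c j * fixpoint r c x / x) = 1"
    by (rule conjunct2[OF conjunct2[OF *]])
qed

lemma block_ratio_limit:
  fixes b :: "nat \<Rightarrow> nat \<Rightarrow> real" and c :: "nat \<Rightarrow> real"
  assumes r: "r \<ge> 1" and b_pos: "\<And>m k. b m k > 0" and b_le: "\<And>m k. k \<le> m \<Longrightarrow> b m k \<le> M"
    and c: "\<And>k. 0 \<le> c k" "\<And>k. c k \<le> M" "\<And>k. c (k + r) = c k"
    and lim: "\<And>j. (\<lambda>m. b m (m - j) - c (m - j)) \<longlonglongrightarrow> 0"
  obtains F X where "F holomorphic_on - \<real>\<^sub>\<le>\<^sub>0" "X > 0"
    "\<And>x. x \<ge> X \<Longrightarrow> F (of_real x) = of_real (fixpoint r c x)"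
    "\<And>K. compact K \<Longrightarrow> K \<subseteq> - \<real>\<^sub>\<le>\<^sub>0 \<Longrightarrow>
       uniform_limit K (\<lambda>m. block_ratio r (b m) m) F sequentially"
    "\<And>x. x \<notin> \<real>\<^sub>\<le>\<^sub>0 \<Longrightarrow> norm x \<ge> X \<Longrightarrow> norm (F x) \<le> 2 ^ r"
proof -
  have "M > 0" using b_pos[of 0 0] b_le[of 0 0] by simp
  \<comment> \<open>Exceeds both thresholds: \<open>2 * r * M\<close> for the contraction and
    \<open>2^(r+1) * M\<close> for the bound near infinity.\<close>
  define X where "X = 2 * real r * M + 2 ^ (r + 1) * M"
  have X: "X > 0" "X \<ge> 2 * real r * M" "X \<ge> 2 ^ (r + 1) * M"
    unfolding X_def using \<open>M > 0\<close> r by (auto intro!: add_pos_pos)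
  have pt: "(\<lambda>m. block_ratio r (b m) m (of_real x)) \<longlonglongrightarrow> of_real (fixpoint r c x)" if "x \<ge> X" for x
    using that X fixpoint[of x c r] c
    by (intro block_ratio_tendsto_fixed_point[OF r b_pos b_le c lim]) auto
  have bnd: "\<exists>B. \<forall>m. \<forall>x\<in>K. norm (block_ratio r (b m) m x) \<le> B" if "compact K" "K \<subseteq> - \<real>\<^sub>\<le>\<^sub>0" for K
    using block_ratio_locally_bounded[OF that, of r] b_pos by meson
  have A: "complex_of_real ` {X..} \<subseteq> - \<real>\<^sub>\<le>\<^sub>0" "complex_of_real X \<in> - \<real>\<^sub>\<le>\<^sub>0"
    using X by auto
  have pt': "(\<lambda>m. block_ratio r (b m) m x) \<longlonglongrightarrow> of_real (fixpoint r c (Re x))"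
    if "x \<in> complex_of_real ` {X..}" for x
    using that pt by auto
  obtain F where F: "F holomorphic_on - \<real>\<^sub>\<le>\<^sub>0"
    "\<And>x. x \<in> complex_of_real ` {X..} \<Longrightarrow> F x = of_real (fixpoint r c (Re x))"
    "\<And>K. compact K \<Longrightarrow> K \<subseteq> - \<real>\<^sub>\<le>\<^sub>0 \<Longrightarrow>
       uniform_limit K (\<lambda>m. block_ratio r (b m) m) F sequentially"
    by (rule vitali_convergence[OF open_slit connected_slit holomorphic_block_ratio[OF b_pos] bnd A
          islimpt_of_real_atLeast pt']) blast+
  have "norm (F x) \<le> 2 ^ r" if "x \<notin> \<real>\<^sub>\<le>\<^sub>0" "norm x \<ge> X" for x
  proof -
    have "(\<lambda>m. block_ratio r (b m) m x) \<longlonglongrightarrow> F x"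
      using F(3)[of "{x}"] that(1) by (auto intro: tendsto_uniform_limitI)
    moreover have "norm (block_ratio r (b m) m x) \<le> 2 ^ r" for m
    proof -
      have "norm (nratio r (b m) x n) \<ge> 1 / 2" if "n \<le> m + r" for n
        using b_le b_pos X that \<open>norm x \<ge> X\<close> \<open>M > 0\<close>
        by (intro norm_nratio_ge_half[of m "b m" M]) (auto simp: abs_of_pos)
      then show ?thesis using norm_block_ratio_le[of "1 / 2" m r "b m" x] by simp
    qed
    ultimately show ?thesis by (intro Lim_norm_ubound[of sequentially]) auto
  qed
  moreover have "F (of_real x) = of_real (fixpoint r c x)" if "x \<ge> X" for x
    using F(2)[of "of_real x"] that by simp
  ultimately show ?thesis using that[OF F(1) X(1) _ F(3)] by blast
qed

text \<open>Both sides are holomorphic on the slit plane and agree on the ray from \<open>X\<close>,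
  so the identity theorem applies.\<close>

lemma fixpoint_equation_slit:
  assumes F: "F holomorphic_on - \<real>\<^sub>\<le>\<^sub>0" "X > 0"
    "\<And>x. x \<ge> X \<Longrightarrow> F (of_real x) = of_real (fixpoint r c x)"
    and c: "\<And>k. c k \<ge> 0" and x: "x \<notin> \<real>\<^sub>\<le>\<^sub>0"
  shows "F x * (\<Prod>j\<in>{0..<r}. 1 + of_real (c j) * F x / x) = 1"
proof -
  have hol: "(\<lambda>x. F x * (\<Prod>j\<in>{0..<r}. 1 + of_real (c j) * F x / x)) holomorphic_on - \<real>\<^sub>\<le>\<^sub>0"
    by (intro holomorphic_intros F(1)) auto
  have "F (of_real y) * (\<Prod>j\<in>{0..<r}. 1 + of_real (c j) * F (of_real y) / of_real y) = 1"
    if "y \<ge> X" for y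
  proof -
    have "F (of_real y) * (\<Prod>j\<in>{0..<r}. 1 + of_real (c j) * F (of_real y) / of_real y) =
        of_real (fixpoint r c y * (\<Prod>j\<in>{0..<r}. 1 + c j * fixpoint r c y / y))"
      using that by (simp add: F(3))
    also have "\<dots> = 1" using fixpoint(3)[of y c r] that F(2) c by simp
    finally show ?thesis .
  qed
  moreover have "x \<in> - \<real>\<^sub>\<le>\<^sub>0" using x by simp
  ultimately show ?thesis
    using slit_identity[OF hol holomorphic_on_const[of 1] F(2)] by blast
qed

text \<open>Boundedness of \<open>F\<close> gives \<open>F x / x\<close> tending to 0, so the
  product tends to 1; by the equation \<open>F\<close> is its inverse. This excludes the branches
  that grow at infinity.\<close>

lemma fixpoint_branch_at_infinity:
  fixes F :: "complex \<Rightarrow> complex" and c :: "nat \<Rightarrow> real"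
  assumes eq: "\<And>x. x \<in> S \<Longrightarrow> F x * (\<Prod>j\<in>{0..<r}. 1 + of_real (c j) * F x / x) = 1"
    and bnd: "\<And>x. x \<in> S \<Longrightarrow> norm x \<ge> X \<Longrightarrow> norm (F x) \<le> B"
  shows "(F \<longlongrightarrow> 1) (inf at_infinity (principal S))"
proof -
  let ?L = "inf at_infinity (principal S)"
  have ev: "\<forall>\<^sub>F x in ?L. x \<in> S \<and> norm x \<ge> X"
    unfolding eventually_inf_principal eventually_at_infinity by (intro exI[of _ X]) simp
  have inv: "(inverse \<longlongrightarrow> (0 :: complex)) ?L"
    by (rule tendsto_mono[OF inf_le1 tendsto_inverse_0])
  have "((\<lambda>x. F x * inverse x) \<longlongrightarrow> 0) ?L"
  proof (rule Lim_null_comparison)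
    show "\<forall>\<^sub>F x in ?L. norm (F x * inverse x) \<le> B * norm (inverse x)"
      using ev by eventually_elim (auto simp: norm_mult intro!: mult_right_mono bnd)
    show "((\<lambda>x :: complex. B * norm (inverse x)) \<longlongrightarrow> 0) ?L"
      using tendsto_mult_right_zero[OF tendsto_norm_zero[OF inv]] .
  qed
  then have "((\<lambda>x. inverse (\<Prod>j\<in>{0..<r}. 1 + of_real (c j) * (F x * inverse x))) \<longlongrightarrow>
      inverse (\<Prod>j\<in>{0..<r}. 1 + of_real (c j) * 0)) ?L"
    by (intro tendsto_intros) auto
  moreover have "\<forall>\<^sub>F x in ?L. inverse (\<Prod>j\<in>{0..<r}. 1 + of_real (c j) * (F x * inverse x)) = F x"
    using ev
  proof eventually_elim
    case (elim x)
    then have "(\<Prod>j\<in>{0..<r}. 1 + of_real (c j) * (F x * inverse x)) * F x = 1"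
      using eq[of x] by (simp add: divide_inverse mult_ac)
    then show ?case by (rule inverse_unique)
  qed
  ultimately show ?thesis by (simp add: tendsto_cong)
qed

section \<open>Application to the polynomials\<close>

lemma Q_initial:
  assumes "N > 0" "n \<le> r"
  shows "Q r g \<gamma> n z N = z ^ n"
proof -
  have "real N powr (- (real n * \<gamma> / real (r + 1))) * (real N powr (\<gamma> / real (r + 1))) ^ n = 1"
    using assms(1) by (simp add: powr_power powr_add[symmetric] field_simps)
  then have "complex_of_real (real N powr (- (real n * \<gamma> / real (r + 1)))) *
      of_real (real N powr (\<gamma> / real (r + 1))) ^ n = 1"
    by (metis of_real_1 of_real_mult of_real_power)
  then show ?thesis
    using assms(2) by (simp add: Q_def P_initial poly_monom power_mult_distrib mult.assoc[symmetric])
qed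

text \<open>The normalizing exponents of degrees \<open>n + r + 1\<close> and \<open>n\<close>
  differ by exactly \<open>\<gamma>\<close>, which turns the coefficient into
  \<open>g n / N powr \<gamma>\<close>.\<close>

lemma Q_rec:
  assumes "N > 0"
  shows "Q r g \<gamma> (n + r + 1) z N =
    z * Q r g \<gamma> (n + r) z N - of_real (g n / real N powr \<gamma>) * Q r g \<gamma> n z N"
proof -
  define w where "w k = real N powr (- (real k * \<gamma> / real (r + 1)))" for k
  define s where "s = real N powr (\<gamma> / real (r + 1))"
  have Q: "Q r g \<gamma> k z N = of_real (w k) * poly (P r g k) (of_real s * z)" for k
    by (simp add: Q_def w_def s_def)
  define R where "R = real (r + 1)"
  have R: "R > 0" "real (n + r + 1) = real n + R" "real (n + r + 1) = real (n + r) + 1"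
    by (auto simp: R_def)
  have "- (real (n + r + 1) * \<gamma> / R) + \<gamma> / R = - (real (n + r) * \<gamma> / R)"
    unfolding R(3) using R(1) by (simp add: field_simps)
  then have 1: "w (n + r + 1) * s = w (n + r)"
    unfolding w_def s_def powr_add[symmetric] R_def by (rule arg_cong)
  have "- (real (n + r + 1) * \<gamma> / R) = - (real n * \<gamma> / R) - \<gamma>"
    unfolding R(2) using R(1) by (simp add: field_simps)
  then have 2: "w (n + r + 1) = w n / real N powr \<gamma>"
    unfolding w_def powr_diff[symmetric] R_def by (rule arg_cong)
  have "Q r g \<gamma> (n + r + 1) z N = of_real (w (n + r + 1)) *
      (of_real s * z * poly (P r g (n + r)) (of_real s * z) - of_real (g n) * poly (P r g n) (of_real s * z))"
    unfolding Q using P_rec[of r "n + r" g] by simp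
  also have "\<dots> = of_real (w (n + r + 1) * s) * z * poly (P r g (n + r)) (of_real s * z) -
      of_real (w (n + r + 1)) * of_real (g n) * poly (P r g n) (of_real s * z)"
    by (simp add: algebra_simps)
  also have "\<dots> = z * Q r g \<gamma> (n + r) z N - of_real (g n / real N powr \<gamma>) * Q r g \<gamma> n z N"
    unfolding 1 unfolding 2 Q by (simp add: algebra_simps)
  finally show ?thesis .
qed

text \<open>The telescoped form of the ratio recurrence. Proving the product formula directly avoids
  dividing by values of \<open>Q\<close> before they are known to be nonzero.\<close>

lemma Q_eq_prod_nratio:
  fixes g :: "nat \<Rightarrow> real" and \<gamma> :: real and z :: complex and N r :: nat
  assumes N: "N > 0" and g: "\<And>n. g n > 0" and z: "- (z ^ (r + 1)) \<notin> \<real>\<^sub>\<le>\<^sub>0"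
  defines "u \<equiv> nratio r (\<lambda>k. g k / real N powr \<gamma>) (- (z ^ (r + 1)))"
  shows "Q r g \<gamma> n z N = z ^ n * (\<Prod>k\<in>{0..<n}. u k)"
proof (induction n rule: less_induct)
  case (less n)
  have z0: "z \<noteq> 0" using z by auto
  show ?case
  proof (cases "n \<le> r")
    case True
    then have "(\<Prod>k\<in>{0..<n}. u k) = 1" by (intro prod.neutral) (auto simp: u_def nratio_initial)
    then show ?thesis using Q_initial[OF N True] by simp
  next
    case False
    define k where "k = n - r - 1"
    have n: "n = k + r + 1" using False by (simp add: k_def)
    define p where "p = (\<Prod>j\<in>{k..<k + r}. u j)"
    define A where "A = (\<Prod>j\<in>{0..<k}. u j)"
    define a where "a = complex_of_real (g k / real N powr \<gamma>)"
    have u0: "u j \<noteq> 0" for j unfolding u_def using nratio_nonzero[OF z] g N by simp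
    have p0: "p \<noteq> 0" unfolding p_def using u0 by simp
    have Ap: "(\<Prod>j\<in>{0..<k + r}. u j) = A * p"
      unfolding A_def p_def by (rule prod.atLeastLessThan_concat[symmetric]) auto
    \<comment> \<open>The sign in \<open>x = - z^(r+1)\<close> turns the plus of the ratio
      recurrence into the minus of the polynomial one.\<close>
    have u: "u (k + r) = 1 - a / (z ^ (r + 1) * p)"
      unfolding u_def p_def a_def by (subst nratio_rec) auto
    have "Q r g \<gamma> n z N = z * (z ^ (k + r) * (A * p)) - a * (z ^ k * A)"
      unfolding n Q_rec[OF N] using less[of "k + r"] less[of k] n Ap by (simp add: A_def a_def)
    also have "\<dots> = z ^ n * (A * p * u (k + r))"
      unfolding u n using z0 p0 by (simp add: field_simps power_add)
    also have "A * p * u (k + r) = (\<Prod>k\<in>{0..<n}. u k)"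
      unfolding n using Ap by simp
    finally show ?thesis .
  qed
qed

lemma Q_ratio_eq_block_ratio:
  assumes "N > 0" "\<And>n. g n > 0" and z: "- (z ^ (r + 1)) \<notin> \<real>\<^sub>\<le>\<^sub>0"
  shows "Q r g \<gamma> n z N / Q r g \<gamma> (n + r) z N =
    block_ratio r (\<lambda>k. g k / real N powr \<gamma>) n (- (z ^ (r + 1))) / z ^ r"
proof -
  let ?u = "nratio r (\<lambda>k. g k / real N powr \<gamma>) (- (z ^ (r + 1)))"
  have z0: "z \<noteq> 0" using z by auto
  have u0: "?u j \<noteq> 0" for j using nratio_nonzero[OF z] assms by simp
  have "(\<Prod>j\<in>{0..<n + r}. ?u j) = (\<Prod>j\<in>{0..<n}. ?u j) * (\<Prod>j\<in>{n..<n + r}. ?u j)"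
    by (rule prod.atLeastLessThan_concat[symmetric]) auto
  moreover have "(\<Prod>j\<in>{0..<n}. ?u j) \<noteq> 0" using u0 by simp
  ultimately show ?thesis
    unfolding Q_eq_prod_nratio[OF assms] block_ratio_def using z0
    by (simp add: power_add field_simps)
qed

lemma \<omega>_power: "\<omega> m ^ k = exp (2 * of_real pi * \<i> * of_nat k / of_nat m)"
  unfolding \<omega>_def exp_of_nat_mult[symmetric] by (simp add: mult_ac)

text \<open>If \<open>z^(r+1)\<close> is a nonnegative real, then \<open>z\<close> is its real root
  times a root of unity, hence on the star. The origin is treated apart since the quotient by the
  root is then meaningless.\<close>

lemma not_in_star_power:
  assumes "z \<notin> star r"
  shows "- (z ^ (r + 1)) \<notin> \<real>\<^sub>\<le>\<^sub>0"
proof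
  assume "- (z ^ (r + 1)) \<in> \<real>\<^sub>\<le>\<^sub>0"
  then obtain y where y: "z ^ (r + 1) = of_real y" "y \<ge> 0"
    by (metis add.inverse_inverse nonpos_Reals_cases neg_0_le_iff_le of_real_minus)
  define x where "x = root (r + 1) y"
  have x: "x \<ge> 0" "x ^ (r + 1) = y" using y by (auto simp: x_def simp del: power_Suc)
  have "\<exists>k\<in>{0..r}. z = of_real x * \<omega> (r + 1) ^ k"
  proof (cases "x = 0")
    case True
    then show ?thesis using x y by (intro bexI[of _ 0]) auto
  next
    case False
    have "(z / of_real x) ^ (r + 1) = 1"
      unfolding power_divide y(1) using False by (simp only: x(2)[symmetric]) simp
    then have "z / of_real x \<in> {exp (2 * of_real pi * \<i> * of_nat j / of_nat (r + 1)) | j. j < r + 1}"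
      by (subst complex_roots_unity[symmetric]) (auto simp del: power_Suc)
    then obtain j where "z / of_real x = exp (2 * of_real pi * \<i> * of_nat j / of_nat (r + 1))" "j < r + 1"
      by blast
    then show ?thesis using False
      by (intro bexI[of _ j]) (auto simp: \<omega>_power field_simps)
  qed
  then have "z \<in> star r" using x(1) by (auto simp: star_def)
  then show False using assms by simp
qed

section \<open>Asymptotics of the rescaled recurrence coefficients\<close>

context
  fixes r :: nat and \<gamma> :: real and \<alpha> :: "nat \<Rightarrow> real" and g :: "nat \<Rightarrow> real"
  assumes r: "r \<ge> 1" and \<gamma>: "\<gamma> > 0"
    and \<alpha>: "\<And>k. k \<in> {1..r} \<Longrightarrow> \<alpha> k > 0"
    and g: "\<And>n. g n > 0"
    and lim: "\<And>k. k \<in> {1..r} \<Longrightarrow>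
           ((\<lambda>n. g n / real n powr \<gamma>) \<longlongrightarrow> \<alpha> k)
             (inf sequentially (principal {n. [n = k - 1] (mod r)}))"
begin

text \<open>Merges the limits along the \<open>r\<close> residue classes into one: there are
  finitely many, and \<open>n mod r + 1\<close> is the class label \<open>k\<close> of
  \<open>n\<close>.\<close>

lemma coeff_diff_tendsto: "(\<lambda>n. g n / real n powr \<gamma> - \<alpha> (n mod r + 1)) \<longlonglongrightarrow> 0"
proof (rule tendstoI)
  fix e :: real assume "e > 0"
  have "\<forall>\<^sub>F n in sequentially. \<forall>k\<in>{1..r}. [n = k - 1] (mod r) \<longrightarrow>
      dist (g n / real n powr \<gamma>) (\<alpha> k) < e"
  proof (intro eventually_ball_finite ballI)
    fix k assume "k \<in> {1..r}"
    from tendstoD[OF lim[OF this] \<open>e > 0\<close>]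
    show "\<forall>\<^sub>F n in sequentially. [n = k - 1] (mod r) \<longrightarrow> dist (g n / real n powr \<gamma>) (\<alpha> k) < e"
      by (simp add: eventually_inf_principal)
  qed auto
  then show "\<forall>\<^sub>F n in sequentially. dist (g n / real n powr \<gamma> - \<alpha> (n mod r + 1)) 0 < e"
  proof eventually_elim
    case (elim n)
    have "n mod r + 1 \<in> {1..r}" using r by (auto simp: Suc_le_eq)
    moreover have "[n = n mod r + 1 - 1] (mod r)" by (simp add: cong_def)
    ultimately have "dist (g n / real n powr \<gamma>) (\<alpha> (n mod r + 1)) < e" using elim by blast
    then show ?case by (simp add: dist_norm)
  qed
qed

lemma \<alpha>_mod_pos: "\<alpha> (n mod r + 1) > 0"
  using \<alpha>[of "n mod r + 1"] r by (auto simp: Suc_le_eq)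

lemma \<alpha>_mod_le: "\<alpha> (n mod r + 1) \<le> (\<Sum>k\<in>{1..r}. \<alpha> k)"
  using r \<alpha> by (intro member_le_sum) (auto simp: Suc_le_eq less_imp_le)

lemma scaled_coeff_bounded:
  assumes N: "\<And>n. N n > 0" and t: "(\<lambda>n. real n / real (N n)) \<longlonglongrightarrow> t"
  obtains B where "\<And>m k. k \<le> m \<Longrightarrow> g k / real (N m) powr \<gamma> \<le> B"
proof -
  have "Bseq (\<lambda>n. g n / real n powr \<gamma> - \<alpha> (n mod r + 1))"
    using coeff_diff_tendsto convergentI convergent_imp_Bseq by blast
  then obtain C where C: "C > 0" "\<And>n. norm (g n / real n powr \<gamma> - \<alpha> (n mod r + 1)) \<le> C"
    using BseqE by blast
  define C' where "C' = C + (\<Sum>k\<in>{1..r}. \<alpha> k)"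
  have C': "g n / real n powr \<gamma> \<le> C'" for n
    using C(2)[of n] \<alpha>_mod_le[of n] unfolding C'_def by (simp add: abs_le_iff)
  have "C' > 0" unfolding C'_def using C(1) \<alpha> by (intro add_pos_nonneg sum_nonneg) (auto simp: less_imp_le)
  have "Bseq (\<lambda>n. real n / real (N n))" using t convergentI convergent_imp_Bseq by blast
  then obtain T where T: "T > 0" "\<And>n. norm (real n / real (N n)) \<le> T" using BseqE by blast
  have "g k / real (N m) powr \<gamma> \<le> C' * T powr \<gamma> + g 0" if "k \<le> m" for m k
  \<comment> \<open>Index 0 is separate because \<open>0 powr \<gamma> = 0\<close> spoils the
    factorization through \<open>g k / real k powr \<gamma>\<close>; the summand \<open>g 0\<close>
    in the bound covers it.\<close>
  proof (cases "k = 0")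
    case True
    have "1 \<le> real (N m) powr \<gamma>" using N[of m] \<gamma> by (intro ge_one_powr_ge_zero) auto
    then have "g 0 / real (N m) powr \<gamma> \<le> g 0 / 1" using g[of 0] N[of m] by (intro divide_left_mono) auto
    moreover have "C' * T powr \<gamma> \<ge> 0" using \<open>C' > 0\<close> by simp
    ultimately show ?thesis unfolding True by linarith
  next
    case False
    have "g k / real (N m) powr \<gamma> = g k / real k powr \<gamma> * (real k / real (N m)) powr \<gamma>"
      using False by (simp add: powr_divide)
    also have "\<dots> \<le> C' * T powr \<gamma>"
    proof (intro mult_mono C' powr_mono2)
      have "real k / real (N m) \<le> real m / real (N m)" using that by (intro divide_right_mono) auto
      also have "\<dots> \<le> T" using T(2)[of m] by simp
      finally show "real k / real (N m) \<le> T" .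
    qed (use \<gamma> \<open>C' > 0\<close> in auto)
    finally show ?thesis using g[of 0] by linarith
  qed
  then show ?thesis using that by blast
qed

text \<open>With \<open>A\<close> the error of \<open>g n / n powr \<gamma>\<close> and
  \<open>\<tau>\<close> the scale factor, the difference is \<open>A * \<tau>\<close> plus a bounded
  factor times \<open>\<tau> - t powr \<gamma>\<close>. A fixed shift \<open>j\<close> does not
  alter the limit of the scale factor.\<close>

lemma scaled_coeff_tendsto:
  assumes N: "\<And>n. N n > 0" and t: "(\<lambda>n. real n / real (N n)) \<longlonglongrightarrow> t" "t > 0"
  shows "(\<lambda>m. g (m - j) / real (N m) powr \<gamma> - \<alpha> ((m - j) mod r + 1) * t powr \<gamma>) \<longlonglongrightarrow> 0"
proof -
  define A where "A n = g n / real n powr \<gamma> - \<alpha> (n mod r + 1)" for n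
  define \<tau> where "\<tau> m = (real (m - j) / real (N m)) powr \<gamma>" for m
  have "(\<lambda>n. real n / real (N n) * inverse (real n)) \<longlonglongrightarrow> t * 0"
    by (intro tendsto_mult t(1) lim_inverse_n)
  then have "(\<lambda>n. real n / real (N n) - real j * (real n / real (N n) * inverse (real n))) \<longlonglongrightarrow> t - real j * (t * 0)"
    by (intro tendsto_diff tendsto_mult_left t(1))
  moreover have "\<forall>\<^sub>F n in sequentially. real n / real (N n) - real j * (real n / real (N n) * inverse (real n)) =
      real (n - j) / real (N n)"
    using eventually_ge_at_top[of "j + 1"]
    by eventually_elim (simp add: of_nat_diff field_simps diff_divide_distrib)
  ultimately have "(\<lambda>n. real (n - j) / real (N n)) \<longlonglongrightarrow> t"
    by (simp add: tendsto_cong)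
  then have \<tau>: "\<tau> \<longlonglongrightarrow> t powr \<gamma>"
    unfolding \<tau>_def[abs_def] using t(2) by (intro tendsto_powr tendsto_const) auto
  have "(\<lambda>m. A (m - j)) \<longlonglongrightarrow> 0"
    using coeff_diff_tendsto by (intro seq_offset_neg) (simp add: A_def)
  then have "(\<lambda>m. A (m - j) * \<tau> m) \<longlonglongrightarrow> 0 * t powr \<gamma>" by (intro tendsto_mult \<tau>)
  moreover have "(\<lambda>m. \<alpha> ((m - j) mod r + 1) * (\<tau> m - t powr \<gamma>)) \<longlonglongrightarrow> 0"
  proof (rule Lim_null_comparison)
    show "\<forall>\<^sub>F m in sequentially. norm (\<alpha> ((m - j) mod r + 1) * (\<tau> m - t powr \<gamma>)) \<le>
        (\<Sum>k\<in>{1..r}. \<alpha> k) * norm (\<tau> m - t powr \<gamma>)"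
      using \<alpha>_mod_pos \<alpha>_mod_le
      by (intro always_eventually allI) (auto simp: abs_mult abs_of_pos intro!: mult_right_mono)
    show "(\<lambda>m. (\<Sum>k\<in>{1..r}. \<alpha> k) * norm (\<tau> m - t powr \<gamma>)) \<longlonglongrightarrow> 0"
      by (intro tendsto_mult_right_zero tendsto_norm_zero LIM_zero \<tau>)
  qed
  ultimately have "(\<lambda>m. A (m - j) * \<tau> m + \<alpha> ((m - j) mod r + 1) * (\<tau> m - t powr \<gamma>)) \<longlonglongrightarrow> 0 * t powr \<gamma> + 0"
    by (rule tendsto_add)
  moreover have "\<forall>\<^sub>F m in sequentially. A (m - j) * \<tau> m + \<alpha> ((m - j) mod r + 1) * (\<tau> m - t powr \<gamma>) =
      g (m - j) / real (N m) powr \<gamma> - \<alpha> ((m - j) mod r + 1) * t powr \<gamma>"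
    using eventually_ge_at_top[of "j + 1"]
  proof eventually_elim
    case (elim m)
    then have "g (m - j) / real (N m) powr \<gamma> = g (m - j) / real (m - j) powr \<gamma> * \<tau> m"
      by (simp add: \<tau>_def powr_divide)
    then show ?case by (simp add: A_def algebra_simps)
  qed
  ultimately show ?thesis by (simp add: tendsto_cong)
qed

end

section \<open>Independence of \<open>N\<close> and transfer from the slit plane to the complement
  of the star\<close>

theorem theorem1p1:
  fixes r :: nat and \<gamma> :: real and \<alpha> :: "nat \<Rightarrow> real" and g :: "nat \<Rightarrow> real"
  assumes "r \<ge> 1"
    and "\<gamma> > 0"
    and "\<And>k. k \<in> {1..r} \<Longrightarrow> \<alpha> k > 0"
    and "\<And>n. g n > 0"
    and "\<And>k. k \<in> {1..r} \<Longrightarrow>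
           ((\<lambda>n. g n / real n powr \<gamma>) \<longlongrightarrow> \<alpha> k)
             (inf sequentially (principal {n. [n = k - 1] (mod r)}))"
  shows "\<exists>\<Phi> :: complex \<Rightarrow> real \<Rightarrow> complex. \<forall>t>0.
           (\<forall>N :: nat \<Rightarrow> nat. (\<forall>n. N n > 0) \<longrightarrow> (\<lambda>n. real n / real (N n)) \<longlonglongrightarrow> t \<longrightarrow>
              (\<forall>K. compact K \<longrightarrow> K \<subseteq> - star r \<longrightarrow>
                 uniform_limit K (\<lambda>n z. Q r g \<gamma> n z (N n) / Q r g \<gamma> (n + r) z (N n))
                   (\<lambda>z. \<Phi> z t) sequentially)) \<and>
           (\<forall>z \<in> - star r.
              1 = \<Phi> z t * (\<Prod>j=1..r. (z - complex_of_real (\<alpha> j * t powr \<gamma>) * \<Phi> z t))) \<and>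
           ((\<lambda>z. z ^ r * \<Phi> z t) \<longlongrightarrow> 1) (inf at_infinity (principal (- star r)))"
proof -
  \<comment> \<open>All properties for a single \<open>t\<close> are bundled so that a function
    \<open>F t\<close> can be chosen for every \<open>t > 0\<close> at once.\<close>
  define limit_fun where "limit_fun t F \<longleftrightarrow>
      (\<forall>N :: nat \<Rightarrow> nat. (\<forall>n. N n > 0) \<longrightarrow> (\<lambda>n. real n / real (N n)) \<longlonglongrightarrow> t \<longrightarrow>
        (\<forall>K. compact K \<longrightarrow> K \<subseteq> - \<real>\<^sub>\<le>\<^sub>0 \<longrightarrow>
          uniform_limit K (\<lambda>n. block_ratio r (\<lambda>k. g k / real (N n) powr \<gamma>) n) F sequentially)) \<and>
      (\<forall>x\<in>- \<real>\<^sub>\<le>\<^sub>0. F x * (\<Prod>j\<in>{0..<r}. 1 + of_real (\<alpha> (j + 1) * t powr \<gamma>) * F x / x) = 1) \<and>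
      (F \<longlongrightarrow> 1) (inf at_infinity (principal (- \<real>\<^sub>\<le>\<^sub>0)))" for t F
  have "\<exists>F. limit_fun t F" if t: "t > 0" for t
  proof -
    define c where "c k = \<alpha> (k mod r + 1) * t powr \<gamma>" for k
    have c: "c k \<ge> 0" "c k \<le> (\<Sum>k\<in>{1..r}. \<alpha> k) * t powr \<gamma>" "c (k + r) = c k" for k
      using \<alpha>_mod_pos[OF assms, of k] \<alpha>_mod_le[OF assms, of k]
      by (auto simp: c_def less_imp_le intro!: mult_right_mono)
    have lim: "\<exists>F X. F holomorphic_on - \<real>\<^sub>\<le>\<^sub>0 \<and> X > 0 \<and>
        (\<forall>x\<ge>X. F (of_real x) = of_real (fixpoint r c x)) \<and>
        (\<forall>K. compact K \<longrightarrow> K \<subseteq> - \<real>\<^sub>\<le>\<^sub>0 \<longrightarrow>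
           uniform_limit K (\<lambda>n. block_ratio r (\<lambda>k. g k / real (N n) powr \<gamma>) n) F sequentially) \<and>
        (\<forall>x. x \<notin> \<real>\<^sub>\<le>\<^sub>0 \<longrightarrow> norm x \<ge> X \<longrightarrow> norm (F x) \<le> 2 ^ r)"
      if N: "\<And>n. N n > 0" "(\<lambda>n. real n / real (N n)) \<longlonglongrightarrow> t" for N :: "nat \<Rightarrow> nat"
    proof -
      obtain B where B: "\<And>m k. k \<le> m \<Longrightarrow> g k / real (N m) powr \<gamma> \<le> B"
        using scaled_coeff_bounded[OF assms N] by blast
      define M where "M = max B ((\<Sum>k\<in>{1..r}. \<alpha> k) * t powr \<gamma>)"
      have "g k / real (N m) powr \<gamma> > 0" for m k using assms(4) N(1) by simp
      moreover have "g k / real (N m) powr \<gamma> \<le> M" if "k \<le> m" for m k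
        using B[OF that] by (simp add: M_def)
      moreover have "c k \<le> M" for k using c(2)[of k] by (simp add: M_def)
      moreover have "(\<lambda>m. g (m - j) / real (N m) powr \<gamma> - c (m - j)) \<longlonglongrightarrow> 0" for j
        unfolding c_def by (rule scaled_coeff_tendsto[OF assms N t])
      ultimately show ?thesis
        by (rule block_ratio_limit[of r "\<lambda>m k. g k / real (N m) powr \<gamma>" M c, OF assms(1) _ _ c(1) _ c(3)])
          (assumption | blast)+
    qed
    \<comment> \<open>One concrete admissible sequence fixes \<open>F\<close> before any other
      \<open>N\<close> is considered. The shift \<open>n + 1\<close> keeps it positive at
      \<open>n = 0\<close>.\<close>
    define N0 where "N0 n = nat \<lceil>real (n + 1) / t\<rceil>" for n
    have N0: "N0 n > 0" for n using t by (simp add: N0_def)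
    have N0_lim: "(\<lambda>n. real n / real (N0 n)) \<longlonglongrightarrow> t"
      unfolding N0_def using t by real_asymp
    obtain F X where F: "F holomorphic_on - \<real>\<^sub>\<le>\<^sub>0" "X > 0"
        "\<And>x. x \<ge> X \<Longrightarrow> F (of_real x) = of_real (fixpoint r c x)"
        "\<And>x. x \<notin> \<real>\<^sub>\<le>\<^sub>0 \<Longrightarrow> norm x \<ge> X \<Longrightarrow> norm (F x) \<le> 2 ^ r"
      using lim[of N0, OF N0 N0_lim] by blast
    have eq: "F x * (\<Prod>j\<in>{0..<r}. 1 + of_real (c j) * F x / x) = 1" if "x \<in> - \<real>\<^sub>\<le>\<^sub>0" for x
      using fixpoint_equation_slit[OF F(1-3) c(1), of x] that by simp
    have "(F \<longlongrightarrow> 1) (inf at_infinity (principal (- \<real>\<^sub>\<le>\<^sub>0)))"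
      using F(4) by (intro fixpoint_branch_at_infinity[where c = c and X = X and B = "2 ^ r", OF eq]) auto
    moreover have "uniform_limit K (\<lambda>n. block_ratio r (\<lambda>k. g k / real (N n) powr \<gamma>) n) F sequentially"
      if NK: "\<forall>n. N n > 0" "(\<lambda>n. real n / real (N n)) \<longlonglongrightarrow> t" "compact K" "K \<subseteq> - \<real>\<^sub>\<le>\<^sub>0" for N K
    proof -
      have N: "N n > 0" for n using NK(1) by blast
      obtain F' X' where F': "F' holomorphic_on - \<real>\<^sub>\<le>\<^sub>0"
          "\<And>x. x \<ge> X' \<Longrightarrow> F' (of_real x) = of_real (fixpoint r c x)"
          "uniform_limit K (\<lambda>n. block_ratio r (\<lambda>k. g k / real (N n) powr \<gamma>) n) F' sequentially"
        using lim[OF N NK(2)] NK(3,4) by blast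
      \<comment> \<open>On a common ray both limits equal \<open>fixpoint r c\<close>, which does
        not involve \<open>N\<close>; hence they agree on the slit plane.\<close>
      have "F' x = F x" if x: "x \<in> - \<real>\<^sub>\<le>\<^sub>0" for x
      proof (rule slit_identity[OF F'(1) F(1) _ _ x])
        show "max X X' > 0" using F(2) by simp
        show "F' (of_real y) = F (of_real y)" if "y \<ge> max X X'" for y
          using that F(3)[of y] F'(2)[of y] by simp
      qed
      then have "F' x = F x" if "x \<in> K" for x using that NK(4) by blast
      then show ?thesis by (intro iffD1[OF uniform_limit_cong' F'(3)] refl)
    qed
    moreover have "(\<Prod>j\<in>{0..<r}. 1 + of_real (c j) * F x / x) =
        (\<Prod>j\<in>{0..<r}. 1 + of_real (\<alpha> (j + 1) * t powr \<gamma>) * F x / x)" for x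
      by (intro prod.cong) (auto simp: c_def)
    ultimately show ?thesis unfolding limit_fun_def using eq by (intro exI[of _ F]) auto
  qed
  then obtain F where limit_fun: "\<And>t. t > 0 \<Longrightarrow> limit_fun t (F t)" by metis
  have F:
    "\<And>N K. \<lbrakk>\<forall>n. N n > 0; (\<lambda>n. real n / real (N n)) \<longlonglongrightarrow> t; compact K; K \<subseteq> - \<real>\<^sub>\<le>\<^sub>0\<rbrakk> \<Longrightarrow>
       uniform_limit K (\<lambda>n. block_ratio r (\<lambda>k. g k / real (N n) powr \<gamma>) n) (F t) sequentially"
    "\<And>x. x \<in> - \<real>\<^sub>\<le>\<^sub>0 \<Longrightarrow>
       F t x * (\<Prod>j\<in>{0..<r}. 1 + of_real (\<alpha> (j + 1) * t powr \<gamma>) * F t x / x) = 1"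
    "(F t \<longlongrightarrow> 1) (inf at_infinity (principal (- \<real>\<^sub>\<le>\<^sub>0)))"
    if "t > 0" for t
    using limit_fun[OF that] unfolding limit_fun_def by blast+
  define p where "p z = - (z ^ (r + 1))" for z :: complex
  have p: "p z \<in> - \<real>\<^sub>\<le>\<^sub>0" if "z \<in> - star r" for z
    using not_in_star_power[of z r] that by (simp add: p_def)
  have z0: "z \<noteq> 0" if "z \<in> - star r" for z
    using p[OF that] by (auto simp: p_def)
  show ?thesis
  \<comment> \<open>Undoing the substitution: \<open>\<Phi> z t\<close> is the limit function at
    \<open>- z^(r+1)\<close>, divided by \<open>z^r\<close>.\<close>
  proof (intro exI[of _ "\<lambda>z t. F t (p z) / z ^ r"] allI impI conjI ballI)
    fix t :: real and N :: "nat \<Rightarrow> nat" and K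
    assume t: "t > 0" and N: "\<forall>n. N n > 0" "(\<lambda>n. real n / real (N n)) \<longlonglongrightarrow> t"
      and K: "compact K" "K \<subseteq> - star r"
    have "continuous_on K p" unfolding p_def by (intro continuous_intros)
    then have "compact (p ` K)" using K(1) compact_continuous_image by blast
    moreover have "p ` K \<subseteq> - \<real>\<^sub>\<le>\<^sub>0" using K(2) p by blast
    ultimately have "uniform_limit (p ` K) (\<lambda>n. block_ratio r (\<lambda>k. g k / real (N n) powr \<gamma>) n) (F t) sequentially"
      by (intro F(1) t N)
    then have ul: "uniform_limit K (\<lambda>n z. block_ratio r (\<lambda>k. g k / real (N n) powr \<gamma>) n (p z))
        (\<lambda>z. F t (p z)) sequentially"
      by (rule uniform_limit_compose') auto
    \<comment> \<open>The origin lies on the star, so \<open>z^r\<close> is bounded away from 0 on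
      \<open>K\<close> and dividing by it preserves uniform convergence.\<close>
    have "bounded ((\<lambda>z. inverse (z ^ r)) ` K)"
      using K z0 by (intro compact_imp_bounded compact_continuous_image continuous_intros) auto
    then obtain B where B: "\<And>z. z \<in> K \<Longrightarrow> norm (inverse (z ^ r)) \<le> B" "B > 0"
      unfolding bounded_pos by auto
    show "uniform_limit K (\<lambda>n z. Q r g \<gamma> n z (N n) / Q r g \<gamma> (n + r) z (N n))
        (\<lambda>z. F t (p z) / z ^ r) sequentially"
      unfolding uniform_limit_iff
    proof (intro allI impI)
      fix e :: real assume "e > 0"
      then have "\<forall>\<^sub>F n in sequentially. \<forall>z\<in>K.
          dist (block_ratio r (\<lambda>k. g k / real (N n) powr \<gamma>) n (p z)) (F t (p z)) < e / B"
        using ul B(2) unfolding uniform_limit_iff by simp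
      then show "\<forall>\<^sub>F n in sequentially. \<forall>z\<in>K.
          dist (Q r g \<gamma> n z (N n) / Q r g \<gamma> (n + r) z (N n)) (F t (p z) / z ^ r) < e"
      proof eventually_elim
        case (elim n)
        show ?case
        proof
          fix z assume z: "z \<in> K"
          let ?w = "block_ratio r (\<lambda>k. g k / real (N n) powr \<gamma>) n (p z)"
          have "Q r g \<gamma> n z (N n) / Q r g \<gamma> (n + r) z (N n) = ?w / z ^ r"
            using Q_ratio_eq_block_ratio[of "N n" g z r \<gamma> n] N(1) assms(4) p[of z] z K(2)
            by (auto simp: p_def)
          then have "dist (Q r g \<gamma> n z (N n) / Q r g \<gamma> (n + r) z (N n)) (F t (p z) / z ^ r) =
              norm (?w - F t (p z)) * norm (inverse (z ^ r))"
            unfolding dist_norm norm_mult[symmetric] by (simp add: divide_inverse left_diff_distrib)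
          also have "\<dots> \<le> norm (?w - F t (p z)) * B"
            using B(1)[OF z] by (intro mult_left_mono) auto
          also have "\<dots> < e / B * B"
            using elim z B(2) by (intro mult_strict_right_mono) (auto simp: dist_norm)
          finally show "dist (Q r g \<gamma> n z (N n) / Q r g \<gamma> (n + r) z (N n)) (F t (p z) / z ^ r) < e"
            using B(2) by simp
        qed
      qed
    qed
  next
    fix t :: real and z assume t: "t > 0" and z: "z \<in> - star r"
    let ?F = "F t (p z)"
    \<comment> \<open>Pulling \<open>z\<close> out of each factor gives \<open>z^r\<close>, which
      cancels the denominator of \<open>\<Phi>\<close> and leaves the equation for
      \<open>F t\<close>.\<close>
    have "(\<Prod>j=1..r. z - of_real (\<alpha> j * t powr \<gamma>) * (?F / z ^ r)) =
        (\<Prod>j\<in>{0..<r}. z * (1 + of_real (\<alpha> (j + 1) * t powr \<gamma>) * ?F / p z))"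
    proof (rule prod.reindex_bij_witness[of _ Suc "\<lambda>j. j - 1"])
      fix j assume "j \<in> {1..r}"
      then show "z * (1 + of_real (\<alpha> (j - 1 + 1) * t powr \<gamma>) * ?F / p z) =
          z - of_real (\<alpha> j * t powr \<gamma>) * (?F / z ^ r)"
        using z0[OF z] by (simp add: p_def field_simps)
    qed auto
    also have "\<dots> = z ^ r * (\<Prod>j\<in>{0..<r}. 1 + of_real (\<alpha> (j + 1) * t powr \<gamma>) * ?F / p z)"
      by (simp add: prod.distrib)
    finally show "1 = ?F / z ^ r * (\<Prod>j=1..r. z - of_real (\<alpha> j * t powr \<gamma>) * (?F / z ^ r))"
      using F(2)[OF t p[OF z]] z0[OF z] by simp
  next
    fix t :: real assume t: "t > 0"
    have "filterlim (\<lambda>z :: complex. z ^ (r + 1)) at_infinity at_infinity"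
      by (intro filterlim_power_at_infinity filterlim_ident) simp
    then have "filterlim p at_infinity at_infinity"
      unfolding p_def filterlim_at_infinity_conv_norm_at_top by (simp only: norm_minus_cancel)
    then have "filterlim p at_infinity (inf at_infinity (principal (- star r)))"
      by (rule filterlim_mono) auto
    moreover have "filterlim p (principal (- \<real>\<^sub>\<le>\<^sub>0)) (inf at_infinity (principal (- star r)))"
      unfolding filterlim_principal eventually_inf_principal using p by auto
    ultimately have "filterlim p (inf at_infinity (principal (- \<real>\<^sub>\<le>\<^sub>0))) (inf at_infinity (principal (- star r)))"
      by (simp add: filterlim_inf)
    from filterlim_compose[OF F(3)[OF t] this]
    have "((\<lambda>z. F t (p z)) \<longlongrightarrow> 1) (inf at_infinity (principal (- star r)))" .
    moreover have "\<forall>\<^sub>F z in inf at_infinity (principal (- star r)). F t (p z) = z ^ r * (F t (p z) / z ^ r)"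
      unfolding eventually_inf_principal using z0 by auto
    ultimately show "((\<lambda>z. z ^ r * (F t (p z) / z ^ r)) \<longlongrightarrow> 1) (inf at_infinity (principal (- star r)))"
      by (rule Lim_transform_eventually)
  qed
qed

end
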